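(* Let $m\geq 1$ and $q\geq 2$ be integers and let $\alpha_1,\dots,\alpha_{q-1}\in\mathbf{C}$ be distinct points. Let $\Sigma$ be either the punctured plane $\mathbf{C}\setminus\{\alpha_1,\dots,\alpha_{q-1}\}$ or the universal cover of that punctured plane. Set $$\omega=\frac{dz}{\prod_{i=1}^{q-1}(z-\alpha_i)},\qquad g=z .$$ Then $g$ omits $q$ distinct values in $\mathbf{C}\cup\{\infty\}$, and the metric $ds^2=(1+|g|^2)^m|\omega|^2$ on $\Sigma$ is complete if and only if $q\leq m+2$. In particular, for every integer $m\geq 1$ there exist an open Riemann surface $\Sigma$, a holomorphic $1$-form $\omega$ and a nonconstant meromorphic function $g$ on $\Sigma$ such that $ds^2=(1+|g|^2)^m|\omega|^2$ is a complete conformal metric on $\Sigma$ and $g$ omits $m+2$ distinct values.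
   Context: Here $z$ is the standard coordinate of $\mathbf{C}$; when $\Sigma$ is the universal cover, $z$, $\omega$ and $g$ denote their pull-backs by the covering map. A meromorphic function $g$ on $\Sigma$ omits a value $\alpha\in\mathbf{C}\cup\{\infty\}$ if $\alpha\notin g(\Sigma)$, where $g$ is regarded as a holomorphic map $\Sigma\to\mathbf{C}\cup\{\infty\}$. An open Riemann surface is a connected non-compact Riemann surface. *)

theory Defs
  imports "HOL-Complex_Analysis.Complex_Analysis"
begin

section \<open>Riemann surfaces\<close>

type_synonym 'a chart = "'a set \<times> ('a \<Rightarrow> complex)"

text \<open>The change of coordinates from the second chart to the first, and more generally the
  expression of a map in local coordinates, are written with \<^const>\<open>inv_into\<close>.\<close>

definition riemann_surface :: "'a topology \<Rightarrow> 'a chart set \<Rightarrow> bool" where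
  "riemann_surface X \<A> \<longleftrightarrow>
     topspace X \<noteq> {} \<and> connected_space X \<and> Hausdorff_space X \<and> second_countable X \<and>
     (\<Union>(U, \<phi>)\<in>\<A>. U) = topspace X \<and>
     (\<forall>(U, \<phi>)\<in>\<A>. openin X U \<and> open (\<phi> ` U) \<and>
        homeomorphic_map (subtopology X U) (top_of_set (\<phi> ` U)) \<phi>) \<and>
     (\<forall>(U, \<phi>)\<in>\<A>. \<forall>(V, \<psi>)\<in>\<A>. (\<psi> \<circ> inv_into U \<phi>) holomorphic_on \<phi> ` (U \<inter> V))"

definition open_riemann_surface :: "'a topology \<Rightarrow> 'a chart set \<Rightarrow> bool" where
  "open_riemann_surface X \<A> \<longleftrightarrow> riemann_surface X \<A> \<and> \<not> compact_space X"

definition holomorphic_map ::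
    "'a topology \<Rightarrow> 'a chart set \<Rightarrow> 'b topology \<Rightarrow> 'b chart set \<Rightarrow> ('a \<Rightarrow> 'b) \<Rightarrow> bool" where
  "holomorphic_map X \<A> Y \<B> f \<longleftrightarrow> continuous_map X Y f \<and>
     (\<forall>(U, \<phi>)\<in>\<A>. \<forall>(V, \<psi>)\<in>\<B>. (\<psi> \<circ> f \<circ> inv_into U \<phi>) holomorphic_on \<phi> ` (U \<inter> f -` V))"

text \<open>The Riemann sphere is the one-point compactification of the plane, \<^const>\<open>None\<close> being
  the point at infinity; its charts are \<open>w\<close> and \<open>1 / w\<close>.\<close>

definition riemann_sphere :: "complex option topology" where
  "riemann_sphere =
     topology (\<lambda>U. open (Some -` U) \<and> (None \<in> U \<longrightarrow> compact (- (Some -` U))))"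

lemma openin_riemann_sphere:
  "openin riemann_sphere U \<longleftrightarrow> open (Some -` U) \<and> (None \<in> U \<longrightarrow> compact (- (Some -` U)))"
proof -
  let ?L = "\<lambda>U. open (Some -` U) \<and> (None \<in> U \<longrightarrow> compact (- (Some -` U :: complex set)))"
  have "?L (S \<inter> T)" if "?L S" "?L T" for S T
    using that by (auto simp: vimage_Int Compl_Int open_Int compact_Un)
  moreover have "?L (\<Union>K)" if K: "\<forall>k\<in>K. ?L k" for K
  proof (intro conjI impI)
    show op: "open (Some -` \<Union>K)"
      using K by (auto simp: vimage_Union)
    assume "None \<in> \<Union>K"
    then obtain k where k: "k \<in> K" "None \<in> k" by blast
    then have "compact (- (Some -` k) \<inter> - (Some -` \<Union>K))"
      using K op by (intro compact_Int_closed) auto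
    moreover have "- (Some -` k) \<inter> - (Some -` \<Union>K) = - (Some -` \<Union>K)"
      using k by auto
    ultimately show "compact (- (Some -` \<Union>K))" by simp
  qed
  ultimately have "istopology ?L" unfolding istopology_def by blast
  then show ?thesis unfolding riemann_sphere_def by simp
qed

definition riemann_sphere_atlas :: "complex option chart set" where
  "riemann_sphere_atlas =
     {(range Some, the), (- {Some 0}, \<lambda>x. case x of None \<Rightarrow> 0 | Some w \<Rightarrow> 1 / w)}"

definition meromorphic_function ::
    "'a topology \<Rightarrow> 'a chart set \<Rightarrow> ('a \<Rightarrow> complex option) \<Rightarrow> bool" where
  "meromorphic_function X \<A> g \<longleftrightarrow>
     holomorphic_map X \<A> riemann_sphere riemann_sphere_atlas g \<and> (\<exists>x\<in>topspace X. g x \<noteq> None)"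

definition omits_distinct_values :: "'a topology \<Rightarrow> ('a \<Rightarrow> complex option) \<Rightarrow> nat \<Rightarrow> bool" where
  "omits_distinct_values X g n \<longleftrightarrow>
     (\<exists>W. finite W \<and> card W = n \<and> (\<forall>w\<in>W. w \<notin> g ` topspace X))"

section \<open>1-forms and conformal metrics\<close>

text \<open>A 1-form of type (1,0) is given by its coefficients: \<open>\<omega> (U, \<phi>) x\<close> is the value at \<open>x\<close> of
  the function \<open>f\<close> such that the form is \<open>f d\<phi>\<close> on \<open>U\<close>.\<close>

definition holomorphic_1form ::
    "'a chart set \<Rightarrow> ('a chart \<Rightarrow> 'a \<Rightarrow> complex) \<Rightarrow> bool" where
  "holomorphic_1form \<A> \<omega> \<longleftrightarrow>
     (\<forall>(U, \<phi>)\<in>\<A>. (\<omega> (U, \<phi>) \<circ> inv_into U \<phi>) holomorphic_on \<phi> ` U) \<and>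
     (\<forall>(U, \<phi>)\<in>\<A>. \<forall>(V, \<psi>)\<in>\<A>. \<forall>x\<in>U \<inter> V.
        \<omega> (U, \<phi>) x = \<omega> (V, \<psi>) x * deriv (\<psi> \<circ> inv_into U \<phi>) (\<phi> x))"

definition differential :: "('a \<Rightarrow> complex) \<Rightarrow> 'a chart \<Rightarrow> 'a \<Rightarrow> complex" where
  "differential f = (\<lambda>(U, \<phi>) x. deriv (f \<circ> inv_into U \<phi>) (\<phi> x))"

text \<open>\<open>k\<close> times continuously differentiable, in the real sense, on an open set.\<close>

primrec Ck_on :: "nat \<Rightarrow> (complex \<Rightarrow> real) \<Rightarrow> complex set \<Rightarrow> bool" where
  "Ck_on 0 f S \<longleftrightarrow> continuous_on S f"
| "Ck_on (Suc k) f S \<longleftrightarrow>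
     (\<exists>fx fy. (\<forall>z\<in>S. (f has_derivative (\<lambda>v. fx z * Re v + fy z * Im v)) (at z)) \<and>
        Ck_on k fx S \<and> Ck_on k fy S)"

text \<open>A conformal metric is given by its coefficients: \<open>h (U, \<phi>) x\<close> is the value at \<open>x\<close> of the
  function \<open>f\<close> such that the metric \<open>ds\<^sup>2\<close> is \<open>f |d\<phi>|\<^sup>2\<close> on \<open>U\<close>.\<close>

definition conformal_metric :: "'a chart set \<Rightarrow> ('a chart \<Rightarrow> 'a \<Rightarrow> real) \<Rightarrow> bool" where
  "conformal_metric \<A> h \<longleftrightarrow>
     (\<forall>(U, \<phi>)\<in>\<A>. (\<forall>x\<in>U. h (U, \<phi>) x > 0) \<and> (\<forall>k. Ck_on k (h (U, \<phi>) \<circ> inv_into U \<phi>) (\<phi> ` U))) \<and>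
     (\<forall>(U, \<phi>)\<in>\<A>. \<forall>(V, \<psi>)\<in>\<A>. \<forall>x\<in>U \<inter> V.
        h (U, \<phi>) x = h (V, \<psi>) x * (cmod (deriv (\<psi> \<circ> inv_into U \<phi>) (\<phi> x)))\<^sup>2)"

text \<open>At the poles of \<open>g\<close> the metric \<open>(1 + |g|\<^sup>2)\<^sup>m |\<omega>|\<^sup>2\<close> is defined by continuous extension; the
  value 0 below is never seen by the limit, the poles being isolated.\<close>

definition ds2 :: "'a topology \<Rightarrow> nat \<Rightarrow> ('a \<Rightarrow> complex option) \<Rightarrow> ('a chart \<Rightarrow> 'a \<Rightarrow> complex)
    \<Rightarrow> 'a chart \<Rightarrow> 'a \<Rightarrow> real" where
  "ds2 X m g \<omega> c x =
     (case g x of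
        Some w \<Rightarrow> (1 + (cmod w)\<^sup>2) ^ m * (cmod (\<omega> c x))\<^sup>2
      | None \<Rightarrow> Lim (atin X x)
          (\<lambda>y. case g y of Some w \<Rightarrow> (1 + (cmod w)\<^sup>2) ^ m * (cmod (\<omega> c y))\<^sup>2 | None \<Rightarrow> 0))"

section \<open>Completeness\<close>

definition piecewise_C1_path :: "'a topology \<Rightarrow> 'a chart set \<Rightarrow> (real \<Rightarrow> 'a) \<Rightarrow> bool" where
  "piecewise_C1_path X \<A> \<gamma> \<longleftrightarrow> pathin X \<gamma> \<and>
     (\<exists>S. finite S \<and>
        (\<forall>(U, \<phi>)\<in>\<A>. (\<phi> \<circ> \<gamma>) C1_differentiable_on ({t\<in>{0..1}. \<gamma> t \<in> U} - S)))"

text \<open>By the transformation rule of a conformal metric the speed does not depend on the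
  chart chosen.\<close>

definition speed :: "'a chart set \<Rightarrow> ('a chart \<Rightarrow> 'a \<Rightarrow> real) \<Rightarrow> (real \<Rightarrow> 'a) \<Rightarrow> real \<Rightarrow> real" where
  "speed \<A> h \<gamma> t =
     (let c = (SOME c. c \<in> \<A> \<and> \<gamma> t \<in> fst c)
      in sqrt (h c (\<gamma> t)) * norm (vector_derivative (snd c \<circ> \<gamma>) (at t)))"

definition path_length :: "'a chart set \<Rightarrow> ('a chart \<Rightarrow> 'a \<Rightarrow> real) \<Rightarrow> (real \<Rightarrow> 'a) \<Rightarrow> ennreal" where
  "path_length \<A> h \<gamma> = (\<integral>\<^sup>+ t\<in>{0..1}. ennreal (speed \<A> h \<gamma> t) \<partial>lborel)"

definition riemannian_dist ::
    "'a topology \<Rightarrow> 'a chart set \<Rightarrow> ('a chart \<Rightarrow> 'a \<Rightarrow> real) \<Rightarrow> 'a \<Rightarrow> 'a \<Rightarrow> real" where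
  "riemannian_dist X \<A> h x y =
     enn2real (INF \<gamma>\<in>{\<gamma>. piecewise_C1_path X \<A> \<gamma> \<and> \<gamma> 0 = x \<and> \<gamma> 1 = y}. path_length \<A> h \<gamma>)"

definition complete_metric ::
    "'a topology \<Rightarrow> 'a chart set \<Rightarrow> ('a chart \<Rightarrow> 'a \<Rightarrow> real) \<Rightarrow> bool" where
  "complete_metric X \<A> h \<longleftrightarrow> Metric_space.mcomplete (topspace X) (riemannian_dist X \<A> h)"

section \<open>The punctured plane and its universal cover\<close>

definition punctured_plane :: "nat \<Rightarrow> (nat \<Rightarrow> complex) \<Rightarrow> complex set" where
  "punctured_plane q \<alpha> = - (\<alpha> ` {1..q-1})"

definition universal_cover ::
    "'a::topological_space set \<Rightarrow> ('a \<Rightarrow> 'b) \<Rightarrow> 'b::topological_space set \<Rightarrow> bool" where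
  "universal_cover E p S \<longleftrightarrow> covering_space E p S \<and> simply_connected E"

text \<open>The complex structure making the local homeomorphism \<open>z\<close> into the plane holomorphic:
  \<open>z\<close> is used as coordinate wherever it is a homeomorphism onto an open set.\<close>

definition pullback_atlas :: "'a topology \<Rightarrow> ('a \<Rightarrow> complex) \<Rightarrow> 'a chart set" where
  "pullback_atlas X z =
     {(U, z) | U. openin X U \<and> open (z ` U) \<and>
        homeomorphic_map (subtopology X U) (top_of_set (z ` U)) z}"

text \<open>The form \<open>dz / \<Prod>(z - \<alpha>\<^sub>i)\<close>. Here \<open>z\<close> is the identity for the punctured plane itself, and the
  covering map for a cover; in the latter case this is the pull-back of the former.\<close>

definition omega_form ::
    "nat \<Rightarrow> (nat \<Rightarrow> complex) \<Rightarrow> ('a \<Rightarrow> complex) \<Rightarrow> 'a chart \<Rightarrow> 'a \<Rightarrow> complex" where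
  "omega_form q \<alpha> z c x = differential z c x / (\<Prod>i=1..q-1. z x - \<alpha> i)"

end

theory Submission
  imports Defs
begin

text \<open>
  Write \<open>n = q - 1\<close>. In the coordinate \<open>z\<close> the metric is \<open>\<rho>\<^sup>2 |dz|\<^sup>2\<close> with
  \<open>\<rho> = (1 + |z|\<^sup>2)\<^bsup>m/2\<^esup> / \<Prod>|z - \<alpha>\<^sub>i|\<close>, and the same holds on every covering of the punctured
  plane when \<open>z\<close> is replaced by the covering map. The punctured plane covers itself, so both surfaces
  of the statement are connected coverings \<open>p : E \<rightarrow> S\<close> of the punctured plane \<open>S\<close>, and one proof
  serves for both (\<open>complete_cover_iff\<close>), a simply connected space being connected.

  The length of a path in \<open>E\<close> is the \<open>\<rho>\<close>-length of its projection. Inside one sheet over a small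
  disc the density lies between positive constants, so the distance of \<open>E\<close> is comparable there to the
  Euclidean distance of the projections, and leaving the sheet costs a definite length. This makes the
  distance a metric and \<open>p\<close> continuous for it.

  If \<open>q \<le> m + 2\<close>, then \<open>n - 1 \<le> m\<close>, so the numerator of \<open>\<rho>\<close> compensates all factors
  \<open>|z - \<alpha>\<^sub>j|\<close> but one, and \<open>1 / |z - \<alpha>\<^sub>i| \<le> B\<^sub>i \<rho>\<close> with a constant \<open>B\<^sub>i\<close>
  (\<open>inverse_dist_le_weight\<close>). Hence each \<open>ln |z - \<alpha>\<^sub>i|\<close> changes by at most \<open>B\<^sub>i\<close> along a path of length
  1, and the endpoints of such paths from a given point stay in a compact part of \<open>S\<close>, away from the punctures
  and from infinity. A Cauchy sequence of \<open>E\<close> therefore has a subsequence whose projections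
  converge in \<open>S\<close>; its tail lies in one sheet over a disc around the limit, and it converges there
  (\<open>complete_if_unit_balls_bounded\<close>).

  If \<open>q > m + 2\<close>, then \<open>\<rho> \<le> C / t\<^sup>2\<close> at the points \<open>t\<close> of the positive real axis far from the
  origin. A lift of this ray to \<open>E\<close> has finite length but no limit, since its projection tends to
  infinity (\<open>incomplete_if_short_ray\<close>).

  The last claim is the case \<open>q = m + 2\<close> of the punctured plane; it remains to see that this is a
  Riemann surface on which \<open>\<omega>\<close> is holomorphic, \<open>z\<close> meromorphic and the metric smooth.
\<close>

section \<open>Lengths of plane curves in a conformal density\<close>

definition conformal_length :: "(complex \<Rightarrow> real) \<Rightarrow> (real \<Rightarrow> complex) \<Rightarrow> ennreal" where
  "conformal_length \<rho> w =
     (\<integral>\<^sup>+ t\<in>{0..1}. ennreal (\<rho> (w t) * norm (vector_derivative w (at t))) \<partial>lborel)"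

text \<open>The endpoints are put into the exceptional set because the derivative of a path there is
  two-sided, hence depends on values outside \<open>{0..1}\<close>.\<close>

lemma valid_path_smooth_off_finite:
  assumes "valid_path w"
  obtains N where "finite N" "{0, 1} \<subseteq> N"
    "\<And>t. t \<in> {0..1} - N \<Longrightarrow> (w has_vector_derivative vector_derivative w (at t)) (at t)"
    "continuous_on ({0..1} - N) (\<lambda>t. vector_derivative w (at t))"
proof -
  obtain N where N: "finite N" "w C1_differentiable_on ({0..1} - N)"
    using assms by (auto simp: valid_path_def piecewise_C1_differentiable_on_def)
  show ?thesis
  proof (rule that[of "N \<union> {0,1}"])
    show "(w has_vector_derivative vector_derivative w (at t)) (at t)" if "t \<in> {0..1} - (N \<union> {0,1})" for t
      using N that unfolding C1_differentiable_on_eq vector_derivative_works[symmetric] by auto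
    show "continuous_on ({0..1} - (N \<union> {0, 1})) (\<lambda>t. vector_derivative w (at t))"
      using N(2) unfolding C1_differentiable_on_eq by (auto intro: continuous_on_subset)
  qed (use N in auto)
qed

lemma borel_measurable_length_density:
  assumes w: "valid_path w" and S: "path_image w \<subseteq> S" and \<rho>: "continuous_on S \<rho>"
  shows "(\<lambda>t. indicator {0..1} t * (\<rho> (w t) * norm (vector_derivative w (at t)))) \<in> borel_measurable borel"
proof -
  obtain N where N: "finite N" "{0,1} \<subseteq> N"
    "continuous_on ({0..1} - N) (\<lambda>t. vector_derivative w (at t))"
    using valid_path_smooth_off_finite[OF w] by metis
  have "continuous_on {0..1} w"
    using w valid_path_imp_path path_def by blast
  then have "continuous_on ({0..1} - N) (\<lambda>t. \<rho> (w t))"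
    using S by (intro continuous_on_compose2[OF \<rho>]) (auto simp: path_image_def intro: continuous_on_subset)
  then have "continuous_on ({0..1} - N) (\<lambda>t. \<rho> (w t) * norm (vector_derivative w (at t)))"
    using N by (intro continuous_intros)
  moreover have "{0..1} - N \<in> sets borel"
    using N by (intro sets.Diff) (auto simp: finite_imp_closed)
  ultimately have "(\<lambda>t. indicator ({0..1} - N) t *\<^sub>R (\<rho> (w t) * norm (vector_derivative w (at t)))) \<in> borel_measurable borel"
    by (intro borel_measurable_continuous_on_indicator)
  then show ?thesis
    by (rule measurable_discrete_difference[where X = N])
      (use N in \<open>auto simp: countable_finite indicator_def\<close>)
qed

lemma conformal_length_alt:
  assumes "path_image w \<subseteq> S" and "\<And>z. z \<in> S \<Longrightarrow> 0 < \<rho> z"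
  shows "conformal_length \<rho> w =
    (\<integral>\<^sup>+ t. ennreal (indicator {0..1} t * (\<rho> (w t) * norm (vector_derivative w (at t)))) \<partial>lborel)"
  unfolding conformal_length_def
  by (intro nn_integral_cong) (auto simp: indicator_def)

lemma conformal_length_reversepath:
  assumes w: "valid_path w" and S: "path_image w \<subseteq> S" and \<rho>: "continuous_on S \<rho>" "\<And>z. z \<in> S \<Longrightarrow> 0 < \<rho> z"
  shows "conformal_length \<rho> (reversepath w) = conformal_length \<rho> w"
proof -
  let ?f = "\<lambda>t. ennreal (indicator {0..1} t * (\<rho> (w t) * norm (vector_derivative w (at t))))"
  have m: "?f \<in> borel_measurable borel"
    using borel_measurable_length_density[OF w S \<rho>(1)] by measurable
  obtain N where N: "finite N"
    "\<And>t. t \<in> {0..1} - N \<Longrightarrow> (w has_vector_derivative vector_derivative w (at t)) (at t)"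
    using valid_path_smooth_off_finite[OF w] by metis
  have "conformal_length \<rho> w = (\<integral>\<^sup>+ t. ?f (1 + (-1) * t) \<partial>lborel)"
    using nn_integral_real_affine[OF m, of "-1" 1] conformal_length_alt[OF S \<rho>(2)] by simp
  also have "\<dots> = conformal_length \<rho> (reversepath w)"
    unfolding conformal_length_def
  proof (rule nn_integral_cong_AE)
    have "AE t in lborel. t \<notin> (\<lambda>t. 1 - t) ` N"
      using N by (intro AE_not_in finite_imp_null_set_lborel finite_imageI)
    then show "AE t in lborel. ?f (1 + (-1) * t) =
        ennreal (\<rho> (reversepath w t) * norm (vector_derivative (reversepath w) (at t))) * indicator {0..1} t"
    proof eventually_elim
      case (elim t)
      show ?case
      proof (cases "t \<in> {0..1}")
        case True
        have "1 - t \<notin> N"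
          using elim by force
        then have "(w has_vector_derivative vector_derivative w (at (1 - t))) (at (1 - t))"
          using N(2)[of "1 - t"] True by auto
        moreover have "((\<lambda>x. 1 - x) has_vector_derivative -1) (at t)"
          by (auto intro!: derivative_eq_intros)
        ultimately have "(w \<circ> (\<lambda>x. 1 - x) has_vector_derivative (-1) *\<^sub>R vector_derivative w (at (1 - t))) (at t)"
          by (intro vector_diff_chain_at)
        then have "vector_derivative (reversepath w) (at t) = - vector_derivative w (at (1 - t))"
          by (intro vector_derivative_at) (simp add: reversepath_def o_def)
        then show ?thesis
          using True by (simp add: reversepath_def)
      qed (auto simp: indicator_def)
    qed
  qed
  finally show ?thesis ..
qed

lemma conformal_length_join:
  assumes w: "valid_path w\<^sub>1" "valid_path w\<^sub>2" and S: "path_image w\<^sub>1 \<subseteq> S" "path_image w\<^sub>2 \<subseteq> S"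
    and \<rho>: "continuous_on S \<rho>" "\<And>z. z \<in> S \<Longrightarrow> 0 < \<rho> z"
  shows "conformal_length \<rho> (w\<^sub>1 +++ w\<^sub>2) = conformal_length \<rho> w\<^sub>1 + conformal_length \<rho> w\<^sub>2"
proof -
  define f where "f w t = ennreal (indicator {0..1} t * (\<rho> (w t) * norm (vector_derivative w (at t))))" for w t
  have [measurable]: "f w\<^sub>1 \<in> borel_measurable borel" "f w\<^sub>2 \<in> borel_measurable borel"
    using borel_measurable_length_density[OF w(1) S(1) \<rho>(1)] borel_measurable_length_density[OF w(2) S(2) \<rho>(1)]
    unfolding f_def by measurable
  obtain N1 where N1: "finite N1"
    "\<And>t. t \<in> {0..1} - N1 \<Longrightarrow> (w\<^sub>1 has_vector_derivative vector_derivative w\<^sub>1 (at t)) (at t)"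
    using valid_path_smooth_off_finite[OF w(1)] by metis
  obtain N2 where N2: "finite N2"
    "\<And>t. t \<in> {0..1} - N2 \<Longrightarrow> (w\<^sub>2 has_vector_derivative vector_derivative w\<^sub>2 (at t)) (at t)"
    using valid_path_smooth_off_finite[OF w(2)] by metis
  have pos: "t \<in> {0..1} \<Longrightarrow> \<rho> (w\<^sub>1 t) > 0" "t \<in> {0..1} \<Longrightarrow> \<rho> (w\<^sub>2 t) > 0" for t
    using S \<rho>(2) by (auto simp: path_image_def image_subset_iff)
  have "conformal_length \<rho> w\<^sub>1 + conformal_length \<rho> w\<^sub>2 =
      2 * (\<integral>\<^sup>+ t. f w\<^sub>1 (0 + 2 * t) \<partial>lborel) + 2 * (\<integral>\<^sup>+ t. f w\<^sub>2 (-1 + 2 * t) \<partial>lborel)"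
    using nn_integral_real_affine[of "f w\<^sub>1" 2 0] nn_integral_real_affine[of "f w\<^sub>2" 2 "-1"]
      conformal_length_alt[OF S(1) \<rho>(2)] conformal_length_alt[OF S(2) \<rho>(2)]
    by (simp flip: f_def)
  also have "\<dots> = (\<integral>\<^sup>+ t. 2 * f w\<^sub>1 (0 + 2 * t) + 2 * f w\<^sub>2 (-1 + 2 * t) \<partial>lborel)"
    by (subst nn_integral_add) (auto simp: nn_integral_cmult)
  also have "\<dots> = conformal_length \<rho> (w\<^sub>1 +++ w\<^sub>2)"
    unfolding conformal_length_def
  proof (rule nn_integral_cong_AE)
    \<comment> \<open>Excluded are the parameters at which one of the paths is not differentiable and those where one of the two summands takes an endpoint value.\<close>
    have "AE t in lborel. t \<notin> insert (1/2) ((\<lambda>t. t / 2) ` insert 0 N1 \<union> (\<lambda>t. (t + 1) / 2) ` insert 1 N2)"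
      using N1 N2 by (intro AE_not_in finite_imp_null_set_lborel) auto
    then show "AE t in lborel. 2 * f w\<^sub>1 (0 + 2 * t) + 2 * f w\<^sub>2 (-1 + 2 * t) =
        ennreal (\<rho> ((w\<^sub>1 +++ w\<^sub>2) t) * norm (vector_derivative (w\<^sub>1 +++ w\<^sub>2) (at t))) * indicator {0..1} t"
    proof eventually_elim
      case (elim t)
      have n1: "2 * t \<notin> insert 0 N1"
      proof
        assume "2 * t \<in> insert 0 N1"
        then have "t \<in> (\<lambda>t. t / 2) ` insert 0 N1"
          by (intro image_eqI[of _ _ "2 * t"]) auto
        with elim show False by blast
      qed
      have n2: "2 * t - 1 \<notin> insert 1 N2"
      proof
        assume "2 * t - 1 \<in> insert 1 N2"
        then have "t \<in> (\<lambda>t. (t + 1) / 2) ` insert 1 N2"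
          by (intro image_eqI[of _ _ "2 * t - 1"]) auto
        with elim show False by blast
      qed
      consider "t < 0" | "t > 1" | "0 < t" "t < 1/2" | "1/2 < t" "t < 1"
        using elim n1 n2 by force
      then show ?case
      proof cases
        case 3
        have "((\<lambda>x. 2 * x) has_vector_derivative 2) (at t)"
          by (auto intro!: derivative_eq_intros)
        moreover have "(w\<^sub>1 has_vector_derivative vector_derivative w\<^sub>1 (at (2 * t))) (at (2 * t))"
          using N1(2)[of "2 * t"] n1 3 by auto
        ultimately have "((\<lambda>x. w\<^sub>1 (2 * x)) has_vector_derivative 2 *\<^sub>R vector_derivative w\<^sub>1 (at (2 * t))) (at t)"
          by (intro vector_diff_chain_at[simplified o_def])
        then have "((w\<^sub>1 +++ w\<^sub>2) has_vector_derivative 2 *\<^sub>R vector_derivative w\<^sub>1 (at (2 * t))) (at t)"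
          by (rule has_vector_derivative_transform_within_open[where S = "{0<..<1/2}"])
            (use 3 in \<open>auto simp: joinpaths_def\<close>)
        then have "vector_derivative (w\<^sub>1 +++ w\<^sub>2) (at t) = 2 *\<^sub>R vector_derivative w\<^sub>1 (at (2 * t))"
          by (rule vector_derivative_at)
        moreover have "f w\<^sub>2 (-1 + 2 * t) = 0"
          using 3 by (simp add: f_def)
        ultimately show ?thesis
          using 3 pos(1)[of "2 * t"] unfolding f_def
          by (simp add: joinpaths_def ennreal_mult' flip: ennreal_numeral) (simp add: mult_ac)
      next
        case 4
        have "((\<lambda>x. 2 * x - 1) has_vector_derivative 2) (at t)"
          by (auto intro!: derivative_eq_intros)
        moreover have "(w\<^sub>2 has_vector_derivative vector_derivative w\<^sub>2 (at (2 * t - 1))) (at (2 * t - 1))"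
          using N2(2)[of "2 * t - 1"] n2 4 by auto
        ultimately have "((\<lambda>x. w\<^sub>2 (2 * x - 1)) has_vector_derivative 2 *\<^sub>R vector_derivative w\<^sub>2 (at (2 * t - 1))) (at t)"
          by (intro vector_diff_chain_at[simplified o_def])
        then have "((w\<^sub>1 +++ w\<^sub>2) has_vector_derivative 2 *\<^sub>R vector_derivative w\<^sub>2 (at (2 * t - 1))) (at t)"
          by (rule has_vector_derivative_transform_within_open[where S = "{1/2<..<1}"])
            (use 4 in \<open>auto simp: joinpaths_def\<close>)
        then have "vector_derivative (w\<^sub>1 +++ w\<^sub>2) (at t) = 2 *\<^sub>R vector_derivative w\<^sub>2 (at (2 * t - 1))"
          by (rule vector_derivative_at)
        moreover have "f w\<^sub>1 (0 + 2 * t) = 0"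
          using 4 by (simp add: f_def)
        ultimately show ?thesis
          using 4 pos(2)[of "2 * t - 1"] unfolding f_def
          by (simp add: joinpaths_def ennreal_mult' flip: ennreal_numeral) (simp add: mult_ac)
      qed (auto simp: f_def)
    qed
  qed
  finally show ?thesis ..
qed

lemma conformal_length_linepath_le:
  assumes "\<And>z. z \<in> closed_segment a b \<Longrightarrow> \<rho> z \<le> M" "0 \<le> M"
  shows "conformal_length \<rho> (linepath a b) \<le> ennreal (M * cmod (b - a))"
proof -
  have "conformal_length \<rho> (linepath a b) \<le> (\<integral>\<^sup>+ t\<in>{0..1::real}. ennreal (M * cmod (b - a)) \<partial>lborel)"
    unfolding conformal_length_def
  proof (intro nn_integral_mono)
    fix t :: real
    show "ennreal (\<rho> (linepath a b t) * norm (vector_derivative (linepath a b) (at t))) * indicator {0..1} t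
       \<le> ennreal (M * cmod (b - a)) * indicator {0..1} t"
      using assms(1)[OF linepath_in_path, of t] 
      by (cases "t \<in> {0..1}") (auto intro!: ennreal_leI mult_right_mono)
  qed
  also have "\<dots> = ennreal (M * cmod (b - a))"
    by (simp add: nn_integral_cmult)
  finally show ?thesis .
qed

text \<open>A function with \<open>|dF| \<le> \<rho> |dz|\<close> is 1-Lipschitz for the length. All lower bounds for lengths come
  from this: with \<open>F\<close> a multiple of the identity near a point, and with \<open>F\<close> a multiple of
  \<open>ln |z - \<alpha>\<^sub>i|\<close> near a puncture or infinity. The derivative is controlled only up to a time
  \<open>\<tau>\<close>, so that the bound applies to a path until it first leaves a disc.

  The fundamental theorem of calculus, in the form for gauge integrals, makes the derivative of the
  continuous function \<open>F \<circ> w\<close> integrable, and the integrand of the length is an integrable majorant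
  of it unless the length is infinite.\<close>

lemma conformal_length_ge:
  fixes F :: "complex \<Rightarrow> 'b::euclidean_space"
  assumes w: "valid_path w" and S: "path_image w \<subseteq> S" and \<rho>: "continuous_on S \<rho>" "\<And>z. z \<in> S \<Longrightarrow> 0 < \<rho> z"
    and F: "continuous_on S F"
    and F': "\<And>z. z \<in> D \<Longrightarrow> (F has_derivative F' z) (at z)"
            "\<And>z v. z \<in> D \<Longrightarrow> norm (F' z v) \<le> \<rho> z * norm v"
    and \<tau>: "\<tau> \<in> {0..1}" and D: "w ` {0<..<\<tau>} \<subseteq> D"
  shows "ennreal (norm (F (w \<tau>) - F (w 0))) \<le> conformal_length \<rho> w"
proof -
  define f where "f t = indicator {0..1} t * (\<rho> (w t) * norm (vector_derivative w (at t)))" for t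
  have f_meas: "f \<in> borel_measurable borel"
    using borel_measurable_length_density[OF w S \<rho>(1)] by (simp add: f_def[abs_def])
  have f_nonneg: "f t \<ge> 0" for t
    using S \<rho>(2)[THEN less_imp_le] unfolding f_def path_image_def
    by (auto simp: indicator_def image_subset_iff)
  have len: "conformal_length \<rho> w = (\<integral>\<^sup>+ t. ennreal (f t) \<partial>lborel)"
    using conformal_length_alt[OF S \<rho>(2)] by (simp add: f_def)
  show ?thesis
  proof (cases "conformal_length \<rho> w")
    case (real r)
    obtain N where N: "finite N" "{0,1} \<subseteq> N"
      "\<And>t. t \<in> {0..1} - N \<Longrightarrow> (w has_vector_derivative vector_derivative w (at t)) (at t)"
      using valid_path_smooth_off_finite[OF w] by metis
    have f_int: "(f has_integral r) UNIV"
      using real len f_meas f_nonneg by (intro nn_integral_has_integral) auto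
    then have f_on: "f integrable_on {0..\<tau>}"
      by (meson f_int has_integral_integrable integrable_on_subinterval subset_UNIV)
    \<comment> \<open>Zero at the exceptional times, so that the bound by \<open>f\<close> holds everywhere.\<close>
    define u where "u t = (if t \<in> {0<..<\<tau>} - N then F' (w t) (vector_derivative w (at t)) else 0)" for t
    have der: "((F \<circ> w) has_vector_derivative u t) (at t)" if t: "t \<in> {0<..<\<tau>} - N" for t
    proof -
      have "w t \<in> D" using D t by auto
      have "(w has_derivative (\<lambda>h. h *\<^sub>R vector_derivative w (at t))) (at t)"
        using N(3)[of t] t \<tau> by (auto simp: has_vector_derivative_def)
      from diff_chain_at[OF this F'(1)[OF \<open>w t \<in> D\<close>]]
      have "((F \<circ> w) has_derivative (F' (w t) \<circ> (\<lambda>h. h *\<^sub>R vector_derivative w (at t)))) (at t)" .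
      moreover have "linear (F' (w t))"
        using F'(1)[OF \<open>w t \<in> D\<close>] has_derivative_linear by blast
      ultimately show ?thesis
        using t by (simp add: u_def has_vector_derivative_def o_def linear_cmul)
    qed
    have "continuous_on {0..1} w"
      using w valid_path_imp_path path_def by blast
    then have "continuous_on {0..\<tau>} (F \<circ> w)"
      using S \<tau> unfolding o_def
      by (intro continuous_on_compose2[OF F]) (auto simp: path_image_def intro: continuous_on_subset)
    then have "(u has_integral ((F \<circ> w) \<tau> - (F \<circ> w) 0)) {0..\<tau>}"
      using der N(1) \<tau> unfolding o_def
      by (intro fundamental_theorem_of_calculus_interior_strong[of N]) simp_all
    moreover have "norm (u t) \<le> f t" if "t \<in> {0..\<tau>}" for t
    proof (cases "t \<in> {0<..<\<tau>} - N")
      case True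
      then have "w t \<in> D" using D by auto
      then show ?thesis
        using True \<tau> F'(2) by (auto simp: u_def f_def)
    qed (use f_nonneg in \<open>auto simp: u_def\<close>)
    ultimately have "norm (F (w \<tau>) - F (w 0)) \<le> integral {0..\<tau>} f"
      using integral_norm_bound_integral[of u "{0..\<tau>}" f] f_on
      by (metis comp_apply has_integral_integrable_integral)
    also have "\<dots> \<le> integral UNIV f"
      using f_int f_nonneg by (intro integral_subset_le) (auto intro: f_on)
    also have "\<dots> = r"
      using f_int by (rule integral_unique)
    finally show ?thesis
      using real by (simp add: ennreal_leI)
  qed simp
qed

text \<open>Paths are total functions on the reals, and a lift can be controlled on the unit interval only;
  the two endpoints, where the derivatives may differ, have measure zero.\<close>

lemma conformal_length_eq_on:
  assumes "\<And>t. t \<in> {0<..<1} \<Longrightarrow> w t = w' t"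
  shows "conformal_length \<rho> w = conformal_length \<rho> w'"
  unfolding conformal_length_def
proof (rule nn_integral_cong_AE)
  have "AE t in lborel. t \<notin> {0, 1::real}"
    by (intro AE_not_in finite_imp_null_set_lborel) auto
  then show "AE t in lborel.
      ennreal (\<rho> (w t) * norm (vector_derivative w (at t))) * indicator {0..1} t =
      ennreal (\<rho> (w' t) * norm (vector_derivative w' (at t))) * indicator {0..1} t"
  proof eventually_elim
    case (elim t)
    show ?case
    proof (cases "t \<in> {0<..<1}")
      case True
      then have "eventually (\<lambda>x. x \<in> {0<..<1}) (nhds t)"
        by (intro eventually_nhds_in_open) auto
      then have "eventually (\<lambda>x. x \<in> UNIV \<longrightarrow> w x = w' x) (nhds t)"
        by eventually_elim (use assms in auto)
      then show ?thesis
        using assms[OF True] vector_derivative_cong_eq[of UNIV w w' t t UNIV] by simp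
    qed (use elim in \<open>auto simp: indicator_def\<close>)
  qed
qed

lemma valid_path_eq_on:
  assumes "valid_path w" and eq: "\<And>t. t \<in> {0..1} \<Longrightarrow> w t = w' t"
  shows "valid_path w'"
proof -
  obtain N where N: "finite N" "{0, 1} \<subseteq> N"
    "\<And>t. t \<in> {0..1} - N \<Longrightarrow> (w has_vector_derivative vector_derivative w (at t)) (at t)"
    "continuous_on ({0..1} - N) (\<lambda>t. vector_derivative w (at t))"
    using valid_path_smooth_off_finite[OF assms(1)] by metis
  have "(w' has_vector_derivative vector_derivative w (at t)) (at t)" if "t \<in> {0..1} - N" for t
  proof (rule has_vector_derivative_transform_within_open[OF N(3)[OF that], of "{0<..<1}"])
    have "t \<noteq> 0" "t \<noteq> 1"
      using that N(2) by auto
    then show "t \<in> {0<..<1}"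
      using that by auto
  qed (use eq in auto)
  then have "w' C1_differentiable_on ({0..1} - N)"
    unfolding C1_differentiable_on_def
    using N(4) by (intro exI[of _ "\<lambda>t. vector_derivative w (at t)"]) auto
  moreover have "continuous_on {0..1} w'"
    using assms(1) valid_path_imp_path path_def eq continuous_on_eq by blast
  ultimately show ?thesis
    using N(1) by (auto simp: valid_path_def piecewise_C1_differentiable_on_def)
qed

section \<open>Coverings of a plane domain\<close>

lemma pullback_atlasE:
  assumes "c \<in> pullback_atlas (top_of_set E) p"
  obtains U where "c = (U, p)" "openin (top_of_set E) U" "open (p ` U)" "inj_on p U"
proof -
  from assms obtain U where U: "c = (U, p)" "openin (top_of_set E) U" "open (p ` U)"
      "homeomorphic_map (subtopology (top_of_set E) U) (top_of_set (p ` U)) p"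
    by (auto simp: pullback_atlas_def)
  moreover have "topspace (subtopology (top_of_set E) U) = U"
    using openin_subset[OF U(2)] by auto
  ultimately show ?thesis
    using that by (auto simp: homeomorphic_map_def)
qed

text \<open>A connected covering of a plane domain, with the metric \<open>(\<rho> \<circ> p)\<^sup>2 |dp|\<^sup>2\<close> pulled back from a
  continuous density \<open>\<rho>\<close> of the base. The coefficients \<open>h\<close> are prescribed only where the metric
  is meaningful, at points of charts.\<close>

locale conformal_cover =
  fixes E :: "'a::topological_space set" and p :: "'a \<Rightarrow> complex" and S :: "complex set"
    and \<rho> :: "complex \<Rightarrow> real" and h :: "'a chart \<Rightarrow> 'a \<Rightarrow> real"
  assumes cover: "covering_space E p S" and open_base: "open S" and connected_total: "connected E"
    and \<rho>_cont: "continuous_on S \<rho>" and \<rho>_pos: "\<And>z. z \<in> S \<Longrightarrow> 0 < \<rho> z"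
    and h_eq: "\<And>c x. c \<in> pullback_atlas (top_of_set E) p \<Longrightarrow> x \<in> fst c \<Longrightarrow> h c x = (\<rho> (p x))\<^sup>2"
begin

abbreviation "atlas \<equiv> pullback_atlas (top_of_set E) p"
abbreviation "d \<equiv> riemannian_dist (top_of_set E) atlas h"
abbreviation "C1_path \<equiv> piecewise_C1_path (top_of_set E) atlas"
abbreviation "len \<equiv> path_length atlas h"

lemma p_cont: "continuous_on E p" and p_image: "p ` E = S"
  using cover by (auto simp: covering_space_def)

lemma p_in: "x \<in> E \<Longrightarrow> p x \<in> S"
  using p_image by blast

text \<open>A sheet over a disc is a part of the preimage of the disc that is both open and closed in it and
  is mapped homeomorphically onto the disc. Stating that the rest of the preimage is open replaces
  mentioning the other sheets.\<close>

definition sheet :: "'a set \<Rightarrow> complex \<Rightarrow> real \<Rightarrow> bool" where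
  "sheet u s r \<longleftrightarrow> u \<subseteq> E \<inter> p -` ball s r \<and> openin (top_of_set E) u \<and>
     openin (top_of_set E) (E \<inter> p -` ball s r - u) \<and> (\<exists>q. homeomorphism u (ball s r) p q)"

text \<open>The radius may be decreased freely: a sheet over a larger set restricts to a sheet over a smaller
  disc. This is used to separate a point of the total space from another one in the same sheet.\<close>

lemma evenly_covered_balls:
  assumes "s \<in> S"
  obtains R where "0 < R" "cball s R \<subseteq> S"
    "\<And>r x. 0 < r \<Longrightarrow> r \<le> R \<Longrightarrow> x \<in> E \<Longrightarrow> p x \<in> ball s r \<Longrightarrow> \<exists>u. x \<in> u \<and> sheet u s r"
proof -
  obtain T \<V> where T: "s \<in> T" "openin (top_of_set S) T" and \<V>: "\<Union>\<V> = E \<inter> p -` T"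
      "\<And>u. u \<in> \<V> \<Longrightarrow> openin (top_of_set E) u" "pairwise disjnt \<V>"
      "\<And>u. u \<in> \<V> \<Longrightarrow> \<exists>q. homeomorphism u T p q"
    using cover assms unfolding covering_space_def by metis
  have "open T" "T \<subseteq> S"
    using T(2) open_base by (auto simp: openin_open_eq)
  then obtain R where R: "0 < R" "cball s R \<subseteq> T"
    using T(1) open_contains_cball by metis
  show ?thesis
  proof (rule that[of R])
    fix r x assume r: "0 < r" "r \<le> R" and x: "x \<in> E" "p x \<in> ball s r"
    have B: "ball s r \<subseteq> T"
      using R r by (meson ball_subset_cball order_trans subset_ball)
    obtain u\<^sub>0 where u\<^sub>0: "u\<^sub>0 \<in> \<V>" "x \<in> u\<^sub>0"
      using \<V>(1) x B by blast
    obtain q where q: "homeomorphism u\<^sub>0 T p q"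
      using \<V>(4) u\<^sub>0 by blast
    define u where "u = u\<^sub>0 \<inter> p -` ball s r"
    have u\<^sub>0E: "v \<subseteq> E" if "v \<in> \<V>" for v
      using \<V>(1) that by blast
    have preimage: "openin (top_of_set E) (v \<inter> p -` ball s r)" if "v \<in> \<V>" for v
    proof -
      have "openin (top_of_set E) (E \<inter> p -` ball s r)"
        by (intro continuous_openin_preimage_gen[OF p_cont]) auto
      then have "openin (top_of_set E) (v \<inter> (E \<inter> p -` ball s r))"
        using \<V>(2)[OF that] by (rule openin_Int[rotated])
      moreover have "v \<inter> (E \<inter> p -` ball s r) = v \<inter> p -` ball s r"
        using u\<^sub>0E[OF that] by blast
      ultimately show ?thesis by simp
    qed
    have "E \<inter> p -` ball s r - u = \<Union>((\<lambda>v. v \<inter> p -` ball s r) ` (\<V> - {u\<^sub>0}))"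
    proof -
      have disj: "v \<inter> u\<^sub>0 = {}" if "v \<in> \<V>" "v \<noteq> u\<^sub>0" for v
        using \<V>(3) u\<^sub>0(1) that by (auto simp: pairwise_def disjnt_def)
      moreover have "E \<inter> p -` ball s r = \<Union>\<V> \<inter> p -` ball s r"
        using \<V>(1) B by blast
      ultimately have "E \<inter> p -` ball s r - u = \<Union>\<V> \<inter> p -` ball s r - u\<^sub>0"
        unfolding u_def by auto
      also have "\<dots> = \<Union>((\<lambda>v. v \<inter> p -` ball s r) ` (\<V> - {u\<^sub>0}))"
        using disj by fastforce
      finally show ?thesis .
    qed
    then have "openin (top_of_set E) (E \<inter> p -` ball s r - u)"
      using preimage by (metis (no_types, lifting) openin_Union DiffD1 imageE)
    moreover have "homeomorphism u (ball s r) p q"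
    proof (rule homeomorphism_of_subsets[OF q])
      show "p ` u = ball s r"
        using q B unfolding u_def homeomorphism_def by force
    qed (use B in \<open>auto simp: u_def\<close>)
    ultimately have "sheet u s r"
      unfolding sheet_def using preimage u\<^sub>0 u\<^sub>0E by (auto simp: u_def)
    then show "\<exists>u. x \<in> u \<and> sheet u s r"
      using x u\<^sub>0 by (intro exI[of _ u]) (auto simp: u_def)
  qed (use R \<open>T \<subseteq> S\<close> in auto)
qed

lemma sheet_in_atlas:
  assumes "sheet u s r"
  shows "(u, p) \<in> atlas"
proof -
  obtain q where q: "homeomorphism u (ball s r) p q"
    using assms by (auto simp: sheet_def)
  then have im: "p ` u = ball s r"
    by (simp add: homeomorphism_def)
  have "E \<inter> u = u"
    using assms by (auto simp: sheet_def)
  moreover have "homeomorphic_map (top_of_set u) (top_of_set (ball s r)) p"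
    using q unfolding homeomorphic_map_maps homeomorphic_maps_def homeomorphism_def
    by (intro exI[of _ q]) auto
  ultimately show ?thesis
    using assms im by (auto simp: pullback_atlas_def sheet_def subtopology_subtopology)
qed

lemma ex_chart: "x \<in> E \<Longrightarrow> \<exists>c\<in>atlas. x \<in> fst c"
proof -
  assume "x \<in> E"
  obtain R where "0 < R" "\<exists>u. x \<in> u \<and> sheet u (p x) R"
    using evenly_covered_balls[OF p_in[OF \<open>x \<in> E\<close>]] \<open>x \<in> E\<close>
    by (metis centre_in_ball order_refl)
  then show ?thesis
    using sheet_in_atlas by force
qed

text \<open>All charts are restrictions of \<open>p\<close>, so regularity of \<open>\<gamma>\<close> in the charts is regularity of
  \<open>p \<circ> \<gamma>\<close>: being differentiable with continuous derivative is local, and the parts of the unit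
  interval that \<open>\<gamma>\<close> maps into single charts are open and cover it.\<close>

lemma piecewise_C1_path_iff:
  "C1_path \<gamma> \<longleftrightarrow> continuous_on {0..1} \<gamma> \<and> \<gamma> ` {0..1} \<subseteq> E \<and> valid_path (p \<circ> \<gamma>)"
proof -
  have pathin: "pathin (top_of_set E) \<gamma> \<longleftrightarrow> continuous_on {0..1} \<gamma> \<and> \<gamma> ` {0..1} \<subseteq> E"
    by (simp add: pathin_def continuous_map_in_subtopology image_subset_iff_funcset)
  show ?thesis
  proof (intro iffI conjI; (elim conjE)?)
    assume C1: "C1_path \<gamma>"
    then show c: "continuous_on {0..1} \<gamma>" and im: "\<gamma> ` {0..1} \<subseteq> E"
      using pathin by (auto simp: piecewise_C1_path_def)
    obtain N where N: "finite N"
      "\<And>U. (U, p) \<in> atlas \<Longrightarrow> (p \<circ> \<gamma>) C1_differentiable_on ({t\<in>{0..1}. \<gamma> t \<in> U} - N)"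
      using C1 by (auto simp: piecewise_C1_path_def)
    have loc: "(p \<circ> \<gamma>) differentiable at t \<and>
        continuous (at t within {0..1} - N) (\<lambda>t. vector_derivative (p \<circ> \<gamma>) (at t))"
      if t: "t \<in> {0..1} - N" for t
    proof -
      obtain c where c': "c \<in> atlas" "\<gamma> t \<in> fst c"
        using ex_chart[of "\<gamma> t"] t im by blast
      then obtain U where U: "(U, p) \<in> atlas" "\<gamma> t \<in> U" "openin (top_of_set E) U"
        by (metis pullback_atlasE fst_conv)
      define T where "T = {t\<in>{0..1}. \<gamma> t \<in> U} - N"
      have "openin (top_of_set {0..1}) ({0..1} \<inter> \<gamma> -` U)"
        using c im U(3) by (intro continuous_openin_preimage) auto
      then obtain W where W: "open W" "{0..1} \<inter> \<gamma> -` U = {0..1} \<inter> W"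
        by (auto simp: openin_open)
      have TW: "T = ({0..1} - N) \<inter> W"
        using W(2) unfolding T_def by blast
      have "t \<in> T" using t U by (simp add: T_def)
      have "(p \<circ> \<gamma>) C1_differentiable_on T"
        using N(2)[OF U(1)] by (simp add: T_def)
      then have "(p \<circ> \<gamma>) differentiable at t"
          "continuous (at t within T) (\<lambda>t. vector_derivative (p \<circ> \<gamma>) (at t))"
        using \<open>t \<in> T\<close> by (auto simp: C1_differentiable_on_eq continuous_on_eq_continuous_within)
      moreover have "at t within T = at t within {0..1} - N"
        using \<open>t \<in> T\<close> TW W(1) by (intro at_within_nhd[of t W]) auto
      ultimately show ?thesis by simp
    qed
    then have "(p \<circ> \<gamma>) C1_differentiable_on ({0..1} - N)"
      by (auto simp: C1_differentiable_on_eq continuous_on_eq_continuous_within)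
    moreover have "continuous_on {0..1} (p \<circ> \<gamma>)"
      using c im p_cont by (meson continuous_on_compose continuous_on_subset)
    ultimately show "valid_path (p \<circ> \<gamma>)"
      using N(1) by (auto simp: valid_path_def piecewise_C1_differentiable_on_def)
  next
    assume "continuous_on {0..1} \<gamma>" "\<gamma> ` {0..1} \<subseteq> E" "valid_path (p \<circ> \<gamma>)"
    moreover from this obtain N where "finite N" "(p \<circ> \<gamma>) C1_differentiable_on ({0..1} - N)"
      by (auto simp: valid_path_def piecewise_C1_differentiable_on_def)
    moreover from this have "(snd c \<circ> \<gamma>) C1_differentiable_on ({t\<in>{0..1}. \<gamma> t \<in> fst c} - N)"
      if "c \<in> atlas" for c
      using that by (elim pullback_atlasE) (auto intro: C1_differentiable_on_subset)
    ultimately show "C1_path \<gamma>"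
      unfolding piecewise_C1_path_def using pathin by (auto intro!: exI[of _ N])
  qed
qed

lemma path_length_eq:
  assumes "\<gamma> ` {0..1} \<subseteq> E"
  shows "len \<gamma> = conformal_length \<rho> (p \<circ> \<gamma>)"
  unfolding path_length_def conformal_length_def
proof (intro nn_integral_cong)
  fix t :: real
  show "ennreal (speed atlas h \<gamma> t) * indicator {0..1} t =
      ennreal (\<rho> ((p \<circ> \<gamma>) t) * norm (vector_derivative (p \<circ> \<gamma>) (at t))) * indicator {0..1} t"
  proof (cases "t \<in> {0..1}")
    case True
    then have "\<gamma> t \<in> E" using assms by auto
    define c where "c = (SOME c. c \<in> atlas \<and> \<gamma> t \<in> fst c)"
    have c: "c \<in> atlas" "\<gamma> t \<in> fst c"
      using someI_ex[of "\<lambda>c. c \<in> atlas \<and> \<gamma> t \<in> fst c"] ex_chart[OF \<open>\<gamma> t \<in> E\<close>]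
      unfolding c_def by blast+
    then have "snd c = p" by (elim pullback_atlasE) simp
    moreover have "sqrt (h c (\<gamma> t)) = \<rho> (p (\<gamma> t))"
      using h_eq[OF c] \<rho>_pos[OF p_in[OF \<open>\<gamma> t \<in> E\<close>]] by simp
    ultimately show ?thesis
      by (simp add: speed_def Let_def flip: c_def)
  qed simp
qed

lemma path_image_p:
  assumes "\<gamma> ` {0..1} \<subseteq> E"
  shows "path_image (p \<circ> \<gamma>) \<subseteq> S"
  using assms p_in by (auto simp: path_image_def)

lemma C1_path_reverse:
  assumes "C1_path \<gamma>"
  shows "C1_path (reversepath \<gamma>) \<and> len (reversepath \<gamma>) = len \<gamma>"
proof -
  have \<gamma>: "continuous_on {0..1} \<gamma>" "\<gamma> ` {0..1} \<subseteq> E" "valid_path (p \<circ> \<gamma>)"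
    using assms by (auto simp: piecewise_C1_path_iff)
  have r: "continuous_on {0..1} (reversepath \<gamma>)" "reversepath \<gamma> ` {0..1} \<subseteq> E"
    using \<gamma> path_reversepath[of \<gamma>] path_image_reversepath[of \<gamma>] by (simp_all add: path_def path_image_def)
  show ?thesis
    using \<gamma> r conformal_length_reversepath[OF \<gamma>(3) path_image_p[OF \<gamma>(2)] \<rho>_cont \<rho>_pos]
    by (simp add: piecewise_C1_path_iff path_length_eq path_compose_reversepath)
qed

lemma C1_path_join:
  assumes "C1_path \<gamma>\<^sub>1" "C1_path \<gamma>\<^sub>2" "\<gamma>\<^sub>1 1 = \<gamma>\<^sub>2 0"
  shows "C1_path (\<gamma>\<^sub>1 +++ \<gamma>\<^sub>2) \<and> len (\<gamma>\<^sub>1 +++ \<gamma>\<^sub>2) = len \<gamma>\<^sub>1 + len \<gamma>\<^sub>2"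
proof -
  have 1: "continuous_on {0..1} \<gamma>\<^sub>1" "\<gamma>\<^sub>1 ` {0..1} \<subseteq> E" "valid_path (p \<circ> \<gamma>\<^sub>1)"
    using assms by (auto simp: piecewise_C1_path_iff)
  have 2: "continuous_on {0..1} \<gamma>\<^sub>2" "\<gamma>\<^sub>2 ` {0..1} \<subseteq> E" "valid_path (p \<circ> \<gamma>\<^sub>2)"
    using assms by (auto simp: piecewise_C1_path_iff)
  have f: "pathfinish \<gamma>\<^sub>1 = pathstart \<gamma>\<^sub>2" "pathfinish (p \<circ> \<gamma>\<^sub>1) = pathstart (p \<circ> \<gamma>\<^sub>2)"
    using assms(3) by (auto simp: pathfinish_def pathstart_def)
  have c: "continuous_on {0..1} (\<gamma>\<^sub>1 +++ \<gamma>\<^sub>2)"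
    using 1 2 f by (intro continuous_on_joinpaths) auto
  have i: "(\<gamma>\<^sub>1 +++ \<gamma>\<^sub>2) ` {0..1} \<subseteq> E"
    using path_image_join_subset[of \<gamma>\<^sub>1 \<gamma>\<^sub>2] 1 2 by (auto simp: path_image_def)
  have v: "valid_path (p \<circ> (\<gamma>\<^sub>1 +++ \<gamma>\<^sub>2))"
    unfolding path_compose_join using 1 2 f by (intro valid_path_join) auto
  show ?thesis
    using c i v 1 2 conformal_length_join[OF 1(3) 2(3) path_image_p[OF 1(2)] path_image_p[OF 2(2)] \<rho>_cont \<rho>_pos]
    by (simp add: piecewise_C1_path_iff path_length_eq path_compose_join)
qed

text \<open>At the first time outside the sheet the path cannot lie over the disc: it would then be in the
  remaining part of the preimage, which is open, and would have been there a moment earlier.\<close>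

lemma leave_sheet:
  fixes \<gamma> :: "real \<Rightarrow> 'a"
  assumes u: "sheet u s R" and \<gamma>: "continuous_on {0..1} \<gamma>" "\<gamma> ` {0..1} \<subseteq> E"
    and ends: "\<gamma> 0 \<in> u" "\<gamma> 1 \<notin> u"
  obtains t where "t \<in> {0..1}" "\<gamma> ` {0..<t} \<subseteq> u" "p (\<gamma> t) \<notin> ball s R"
proof -
  have op: "openin (top_of_set {0..1}) ({0..1} \<inter> \<gamma> -` V)" if "openin (top_of_set E) V" for V
    using \<gamma> that by (intro continuous_openin_preimage) auto
  have "closedin (top_of_set {0..1}) ({0..1} - {0..1} \<inter> \<gamma> -` u)"
    using closedin_diff[OF closedin_topspace op[of u]] u by (simp add: sheet_def)
  then have "compact ({0..1} - {0..1} \<inter> \<gamma> -` u)"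
    by (rule closedin_compact[OF compact_Icc])
  moreover have "1 \<in> {0..1} - {0..1} \<inter> \<gamma> -` u"
    using ends by auto
  ultimately obtain t where t: "t \<in> {0..1} - {0..1} \<inter> \<gamma> -` u" "\<forall>t'\<in>{0..1} - {0..1} \<inter> \<gamma> -` u. t \<le> t'"
    using compact_attains_inf by (metis empty_iff)
  have before: "\<gamma> ` {0..<t} \<subseteq> u"
    using t by force
  have "t \<noteq> 0"
    using t ends by auto
  have "p (\<gamma> t) \<notin> ball s R"
  proof
    assume "p (\<gamma> t) \<in> ball s R"
    then have "t \<in> {0..1} \<inter> \<gamma> -` (E \<inter> p -` ball s R - u)"
      using t \<gamma>(2) by auto
    moreover have "openin (top_of_set {0..1}) ({0..1} \<inter> \<gamma> -` (E \<inter> p -` ball s R - u))"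
      using op u by (auto simp: sheet_def)
    ultimately obtain e where e: "e > 0" "\<And>t'. t' \<in> {0..1} \<Longrightarrow> dist t' t < e \<Longrightarrow> \<gamma> t' \<notin> u"
      unfolding openin_euclidean_subtopology_iff by blast
    define t' where "t' = max 0 (t - e/2)"
    have "t' \<in> {0..1}" "dist t' t < e" "t' < t"
      using e(1) t \<open>t \<noteq> 0\<close> by (auto simp: t'_def dist_real_def)
    then show False
      using e(2)[of t'] before by (auto simp: image_subset_iff)
  qed
  then show ?thesis
    using that t before by auto
qed

text \<open>Until it leaves the sheet the path lies over the disc, where \<open>\<rho> \<ge> c\<close>, and its projection has to
  run to the boundary of the disc.\<close>

lemma length_leaving_sheet:
  assumes u: "sheet u s R" and c: "0 \<le> c" "\<And>z. z \<in> ball s R \<Longrightarrow> c \<le> \<rho> z"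
    and \<gamma>: "C1_path \<gamma>" "\<gamma> 0 \<in> u" "\<gamma> 1 \<notin> u"
  shows "ennreal (c * (R - dist s (p (\<gamma> 0)))) \<le> len \<gamma>"
proof -
  have \<gamma>': "continuous_on {0..1} \<gamma>" "\<gamma> ` {0..1} \<subseteq> E" "valid_path (p \<circ> \<gamma>)"
    using \<gamma> by (auto simp: piecewise_C1_path_iff)
  obtain t where t: "t \<in> {0..1}" "\<gamma> ` {0..<t} \<subseteq> u" "p (\<gamma> t) \<notin> ball s R"
    using leave_sheet[OF u \<gamma>'(1,2) \<gamma>(2,3)] .
  have pu: "p ` u \<subseteq> ball s R"
    using u by (auto simp: sheet_def)
  have "c * (R - dist s (p (\<gamma> 0))) \<le> norm (c *\<^sub>R p (\<gamma> t) - c *\<^sub>R p (\<gamma> 0))"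
  proof -
    have "R - dist s (p (\<gamma> 0)) \<le> dist (p (\<gamma> t)) (p (\<gamma> 0))"
      using t(3) dist_triangle[of s "p (\<gamma> t)" "p (\<gamma> 0)"] by (auto simp: dist_commute)
    then show ?thesis
      using c(1) by (simp add: dist_norm mult_left_mono flip: scaleR_diff_right)
  qed
  also have "ennreal \<dots> \<le> conformal_length \<rho> (p \<circ> \<gamma>)"
    using conformal_length_ge[OF \<gamma>'(3) path_image_p[OF \<gamma>'(2)] \<rho>_cont \<rho>_pos,
        where F = "\<lambda>z. c *\<^sub>R z" and F' = "\<lambda>_ v. c *\<^sub>R v" and D = "ball s R" and \<tau> = t]
      t(1,2) c pu by (force intro!: derivative_eq_intros continuous_intros mult_right_mono)
  finally show ?thesis
    using path_length_eq[OF \<gamma>'(2)] by (simp add: ennreal_leI)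
qed

lemma lifted_segment:
  assumes u: "sheet u s R" and ab: "a \<in> u" "b \<in> u"
    and M: "0 \<le> M" "\<And>z. z \<in> closed_segment (p a) (p b) \<Longrightarrow> \<rho> z \<le> M"
  obtains \<gamma> where "C1_path \<gamma>" "\<gamma> 0 = a" "\<gamma> 1 = b" "len \<gamma> \<le> ennreal (M * dist (p a) (p b))"
proof -
  obtain q where q: "homeomorphism u (ball s R) p q"
    using u by (auto simp: sheet_def)
  have uE: "u \<subseteq> E"
    using u by (auto simp: sheet_def)
  define \<gamma> where "\<gamma> = q \<circ> linepath (p a) (p b)"
  have seg: "linepath (p a) (p b) ` {0..1} \<subseteq> ball s R"
  proof -
    have "closed_segment (p a) (p b) \<subseteq> ball s R"
      using u ab by (intro closed_segment_subset convex_ball) (auto simp: sheet_def)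
    then show ?thesis
      using path_image_linepath[of "p a" "p b"] by (simp add: path_image_def)
  qed
  have \<gamma>: "continuous_on {0..1} \<gamma>" "\<gamma> ` {0..1} \<subseteq> u"
  proof -
    have *: "continuous_on (ball s R) q" "q ` ball s R = u"
      using q by (auto simp: homeomorphism_def)
    show "continuous_on {0..1} \<gamma>"
      unfolding \<gamma>_def
      by (intro continuous_on_compose continuous_on_linepath continuous_on_subset[OF *(1) seg])
    show "\<gamma> ` {0..1} \<subseteq> u"
      unfolding \<gamma>_def image_comp[symmetric] *(2)[symmetric] using seg by (rule image_mono)
  qed
  have p\<gamma>: "linepath (p a) (p b) t = (p \<circ> \<gamma>) t" if "t \<in> {0..1}" for t
  proof -
    have "linepath (p a) (p b) t \<in> ball s R"
      using seg that by blast
    then show ?thesis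
      using homeomorphism_apply2[OF q] by (simp add: \<gamma>_def)
  qed
  have "valid_path (p \<circ> \<gamma>)"
    using valid_path_eq_on[of "linepath (p a) (p b)" "p \<circ> \<gamma>"] p\<gamma> by blast
  then have "C1_path \<gamma>"
    using \<gamma> uE by (auto simp: piecewise_C1_path_iff)
  moreover have "\<gamma> 0 = a" "\<gamma> 1 = b"
    using homeomorphism_apply1[OF q] ab by (simp_all add: \<gamma>_def linepath_def)
  moreover have "len \<gamma> \<le> ennreal (M * dist (p a) (p b))"
  proof -
    have "len \<gamma> = conformal_length \<rho> (linepath (p a) (p b))"
      using \<gamma> uE path_length_eq[of \<gamma>] conformal_length_eq_on[of "linepath (p a) (p b)" "p \<circ> \<gamma>" \<rho>] p\<gamma> by force
    also have "\<dots> \<le> ennreal (M * cmod (p b - p a))"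
      using M by (intro conformal_length_linepath_le) auto
    finally show ?thesis
      by (simp add: dist_norm norm_minus_commute)
  qed
  ultimately show ?thesis
    using that by blast
qed

section \<open>The distance on a covering and its completeness\<close>

lemma sheet_at:
  assumes "x \<in> E"
  obtains R u where "0 < R" "cball (p x) R \<subseteq> S" "x \<in> u" "sheet u (p x) R"
  using evenly_covered_balls[OF p_in[OF assms]] assms by (metis centre_in_ball order_refl)

lemma \<rho>_bounds:
  assumes "cball s R \<subseteq> S" "0 < R"
  obtains c M where "0 < c" "0 \<le> M" "\<And>z. z \<in> cball s R \<Longrightarrow> c \<le> \<rho> z \<and> \<rho> z \<le> M"
proof -
  have cont: "continuous_on (cball s R) \<rho>" and ne: "cball s R \<noteq> {}"
    using \<rho>_cont assms continuous_on_subset by auto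
  obtain a where a: "a \<in> cball s R" "\<forall>z\<in>cball s R. \<rho> a \<le> \<rho> z"
    using continuous_attains_inf[OF compact_cball ne cont] by blast
  obtain b where b: "b \<in> cball s R" "\<forall>z\<in>cball s R. \<rho> z \<le> \<rho> b"
    using continuous_attains_sup[OF compact_cball ne cont] by blast
  show ?thesis
    using that[of "\<rho> a" "\<rho> b"] a b assms \<rho>_pos by (meson less_imp_le subsetD)
qed

text \<open>Being joined by a path of finite length is an equivalence relation with open classes, since inside
  a sheet the lift of a segment joins two points; the total space is connected.\<close>

lemma finite_length_path:
  assumes "x \<in> E" "y \<in> E"
  shows "\<exists>\<gamma>. C1_path \<gamma> \<and> \<gamma> 0 = x \<and> \<gamma> 1 = y \<and> len \<gamma> < \<infinity>"
proof (rule connected_equivalence_relation[OF connected_total assms])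
  fix x y assume "\<exists>\<gamma>. C1_path \<gamma> \<and> \<gamma> 0 = x \<and> \<gamma> 1 = y \<and> len \<gamma> < \<infinity>"
  then obtain \<gamma> where "C1_path \<gamma>" "\<gamma> 0 = x" "\<gamma> 1 = y" "len \<gamma> < \<infinity>" by blast
  then show "\<exists>\<gamma>. C1_path \<gamma> \<and> \<gamma> 0 = y \<and> \<gamma> 1 = x \<and> len \<gamma> < \<infinity>"
    using C1_path_reverse[of \<gamma>] by (intro exI[of _ "reversepath \<gamma>"]) (auto simp: reversepath_def)
next
  fix x y z
  assume "\<exists>\<gamma>. C1_path \<gamma> \<and> \<gamma> 0 = x \<and> \<gamma> 1 = y \<and> len \<gamma> < \<infinity>"
    and "\<exists>\<gamma>. C1_path \<gamma> \<and> \<gamma> 0 = y \<and> \<gamma> 1 = z \<and> len \<gamma> < \<infinity>"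
  then obtain \<gamma>\<^sub>1 \<gamma>\<^sub>2 where "C1_path \<gamma>\<^sub>1" "\<gamma>\<^sub>1 0 = x" "\<gamma>\<^sub>1 1 = y" "len \<gamma>\<^sub>1 < \<infinity>"
    "C1_path \<gamma>\<^sub>2" "\<gamma>\<^sub>2 0 = y" "\<gamma>\<^sub>2 1 = z" "len \<gamma>\<^sub>2 < \<infinity>" by blast
  then show "\<exists>\<gamma>. C1_path \<gamma> \<and> \<gamma> 0 = x \<and> \<gamma> 1 = z \<and> len \<gamma> < \<infinity>"
    using C1_path_join[of \<gamma>\<^sub>1 \<gamma>\<^sub>2]
    by (intro exI[of _ "\<gamma>\<^sub>1 +++ \<gamma>\<^sub>2"]) (auto simp: joinpaths_def less_top)
next
  fix x assume x: "x \<in> E"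
  obtain R u where u: "0 < R" "cball (p x) R \<subseteq> S" "x \<in> u" "sheet u (p x) R"
    using sheet_at[OF x] .
  obtain c M where M: "0 < c" "0 \<le> M" "\<And>z. z \<in> cball (p x) R \<Longrightarrow> c \<le> \<rho> z \<and> \<rho> z \<le> M"
    using \<rho>_bounds[OF u(2,1)] by blast
  have "\<exists>\<gamma>. C1_path \<gamma> \<and> \<gamma> 0 = x \<and> \<gamma> 1 = y \<and> len \<gamma> < \<infinity>" if y: "y \<in> u" for y
  proof -
    have "closed_segment (p x) (p y) \<subseteq> ball (p x) R"
      using u y by (intro closed_segment_subset convex_ball) (auto simp: sheet_def)
    then have "\<rho> z \<le> M" if "z \<in> closed_segment (p x) (p y)" for z
      using M(3) that by auto
    then obtain \<gamma> where "C1_path \<gamma>" "\<gamma> 0 = x" "\<gamma> 1 = y" "len \<gamma> \<le> ennreal (M * dist (p x) (p y))"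
      using lifted_segment[OF u(4,3) y M(2)] by blast
    then show ?thesis
      using le_less_trans ennreal_less_top by (metis infinity_ennreal_def)
  qed
  then show "\<exists>T. openin (top_of_set E) T \<and> x \<in> T \<and>
      (\<forall>y\<in>T. \<exists>\<gamma>. C1_path \<gamma> \<and> \<gamma> 0 = x \<and> \<gamma> 1 = y \<and> len \<gamma> < \<infinity>)"
    using u by (auto simp: sheet_def)
qed

text \<open>Since paths of finite length exist, no information is lost when the infimum is turned into a real
  number.\<close>

lemma dist_finite:
  assumes "x \<in> E" "y \<in> E"
  shows "ennreal (d x y) = (INF \<gamma>\<in>{\<gamma>. C1_path \<gamma> \<and> \<gamma> 0 = x \<and> \<gamma> 1 = y}. len \<gamma>)"
proof -
  obtain \<gamma> where "C1_path \<gamma>" "\<gamma> 0 = x" "\<gamma> 1 = y" "len \<gamma> < \<infinity>"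
    using finite_length_path[OF assms] by blast
  then have "(INF \<gamma>\<in>{\<gamma>. C1_path \<gamma> \<and> \<gamma> 0 = x \<and> \<gamma> 1 = y}. len \<gamma>) < top"
    by (intro le_less_trans[OF INF_lower[of \<gamma>]]) auto
  then show ?thesis
    unfolding riemannian_dist_def by (intro ennreal_enn2real)
qed

lemma dist_le_length:
  assumes "C1_path \<gamma>" "\<gamma> 0 = x" "\<gamma> 1 = y" "len \<gamma> \<le> ennreal L" "0 \<le> L"
  shows "d x y \<le> L"
proof -
  have "x \<in> E" "y \<in> E"
    using assms by (auto simp: piecewise_C1_path_iff)
  then have "ennreal (d x y) \<le> len \<gamma>"
    using assms by (auto simp: dist_finite intro!: INF_lower)
  then show ?thesis
    using assms by (meson ennreal_le_iff order_trans)
qed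

lemma near_optimal_path:
  assumes "x \<in> E" "y \<in> E" "d x y < L"
  obtains \<gamma> where "C1_path \<gamma>" "\<gamma> 0 = x" "\<gamma> 1 = y" "len \<gamma> < ennreal L"
proof -
  have "d x y \<ge> 0"
    by (simp add: riemannian_dist_def)
  then have "(INF \<gamma>\<in>{\<gamma>. C1_path \<gamma> \<and> \<gamma> 0 = x \<and> \<gamma> 1 = y}. len \<gamma>) < ennreal L"
    using assms by (simp add: ennreal_less_iff flip: dist_finite)
  then show ?thesis
    using that by (auto simp: INF_less_iff)
qed

lemma stays_in_sheet:
  assumes "sheet u s R" "0 \<le> c" "\<And>z. z \<in> ball s R \<Longrightarrow> c \<le> \<rho> z"
    and "x \<in> u" "y \<in> E" "d x y < c * (R - dist s (p x))"
  shows "y \<in> u"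
proof (rule ccontr)
  assume "y \<notin> u"
  have "x \<in> E"
    using assms by (auto simp: sheet_def)
  then obtain \<gamma> where "C1_path \<gamma>" "\<gamma> 0 = x" "\<gamma> 1 = y" "len \<gamma> < ennreal (c * (R - dist s (p x)))"
    using near_optimal_path assms by metis
  then show False
    using length_leaving_sheet[of u s R c \<gamma>] assms \<open>y \<notin> u\<close> by simp
qed

lemma dist_in_sheet_le:
  assumes "sheet u s R" "x \<in> u" "y \<in> u" "0 \<le> M" "\<And>z. z \<in> closed_segment (p x) (p y) \<Longrightarrow> \<rho> z \<le> M"
  shows "d x y \<le> M * dist (p x) (p y)"
proof -
  obtain \<gamma> where "C1_path \<gamma>" "\<gamma> 0 = x" "\<gamma> 1 = y" "len \<gamma> \<le> ennreal (M * dist (p x) (p y))"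
    using lifted_segment[OF assms] .
  then show ?thesis
    using dist_le_length assms(4) by simp
qed

lemma d_commute: "d x y = d y x"
proof -
  have "len ` {\<gamma>. C1_path \<gamma> \<and> \<gamma> 0 = x \<and> \<gamma> 1 = y} \<subseteq> len ` {\<gamma>. C1_path \<gamma> \<and> \<gamma> 0 = y \<and> \<gamma> 1 = x}" for x y
  proof clarify
    fix \<gamma> assume "C1_path \<gamma>"
    then show "len \<gamma> \<in> len ` {\<gamma>'. C1_path \<gamma>' \<and> \<gamma>' 0 = \<gamma> 1 \<and> \<gamma>' 1 = \<gamma> 0}"
      using C1_path_reverse[of \<gamma>] by (intro image_eqI[of _ _ "reversepath \<gamma>"]) (auto simp: reversepath_def)
  qed
  then have "len ` {\<gamma>. C1_path \<gamma> \<and> \<gamma> 0 = x \<and> \<gamma> 1 = y} = len ` {\<gamma>. C1_path \<gamma> \<and> \<gamma> 0 = y \<and> \<gamma> 1 = x}"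
    by (meson subset_antisym)
  then show ?thesis
    by (simp add: riemannian_dist_def)
qed

text \<open>Two distinct points have positive distance because a sheet around the first, over a disc so small
  that the second point is not in it, cannot be left by short paths.\<close>

lemma metric: "Metric_space E d"
proof
  fix x y z
  show "0 \<le> d x y"
    by (simp add: riemannian_dist_def)
  show "d x y = d y x"
    by (rule d_commute)
  assume x: "x \<in> E" and y: "y \<in> E"
  show "d x y = 0 \<longleftrightarrow> x = y"
  proof
    assume "d x y = 0"
    show "x = y"
    proof (rule ccontr)
      assume "x \<noteq> y"
      obtain R where R: "0 < R" "cball (p x) R \<subseteq> S"
          "\<And>r. 0 < r \<Longrightarrow> r \<le> R \<Longrightarrow> \<exists>u. x \<in> u \<and> sheet u (p x) r"
        using evenly_covered_balls[OF p_in[OF x]] x by (metis centre_in_ball)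
      \<comment> \<open>Over a disc of this radius around \<open>p x\<close> the point \<open>y\<close> is in no sheet through \<open>x\<close>: it is excluded by its projection if this differs from \<open>p x\<close>, and by injectivity otherwise.\<close>
      define r where "r = (if p y = p x then R else min R (dist (p x) (p y)))"
      have r: "0 < r" "r \<le> R"
        using R by (auto simp: r_def)
      obtain u where u: "x \<in> u" "sheet u (p x) r"
        using R(3) r by blast
      obtain c M where c: "0 < c" "\<And>z. z \<in> cball (p x) R \<Longrightarrow> c \<le> \<rho> z \<and> \<rho> z \<le> M"
        using \<rho>_bounds[OF R(2,1)] by metis
      have "y \<in> u"
        using u y c r \<open>d x y = 0\<close> by (intro stays_in_sheet[of u "p x" r c x y]) auto
      then have "p y \<in> ball (p x) r" "inj_on p u"
        using u by (auto simp: sheet_def homeomorphism_def inj_on_def)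
      moreover have "p x \<noteq> p y"
        using \<open>inj_on p u\<close> \<open>x \<noteq> y\<close> u \<open>y \<in> u\<close> by (auto dest: inj_onD)
      ultimately show False
        by (auto simp: r_def)
    qed
  next
    assume "x = y"
    obtain R u where u: "0 < R" "cball (p x) R \<subseteq> S" "x \<in> u" "sheet u (p x) R"
      using sheet_at[OF x] .
    have "d x x \<le> \<rho> (p x) * dist (p x) (p x)"
      using u \<rho>_pos[OF p_in[OF x]] by (intro dist_in_sheet_le[of u "p x" R]) auto
    then show "d x y = 0"
      using \<open>x = y\<close> by (simp add: riemannian_dist_def order_antisym)
  qed
  assume z: "z \<in> E"
  show "d x z \<le> d x y + d y z"
  proof (rule field_le_epsilon)
    fix e :: real assume "e > 0"
    obtain \<gamma>\<^sub>1 where 1: "C1_path \<gamma>\<^sub>1" "\<gamma>\<^sub>1 0 = x" "\<gamma>\<^sub>1 1 = y" "len \<gamma>\<^sub>1 < ennreal (d x y + e/2)"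
      using near_optimal_path[OF x y, of "d x y + e/2"] \<open>e > 0\<close> by auto
    obtain \<gamma>\<^sub>2 where 2: "C1_path \<gamma>\<^sub>2" "\<gamma>\<^sub>2 0 = y" "\<gamma>\<^sub>2 1 = z" "len \<gamma>\<^sub>2 < ennreal (d y z + e/2)"
      using near_optimal_path[OF y z, of "d y z + e/2"] \<open>e > 0\<close> by auto
    have nn: "0 \<le> d x y" "0 \<le> d y z"
      by (simp_all add: riemannian_dist_def)
    have "len (\<gamma>\<^sub>1 +++ \<gamma>\<^sub>2) \<le> ennreal (d x y + e/2) + ennreal (d y z + e/2)"
      using C1_path_join[OF 1(1) 2(1)] 1 2 by (auto intro!: add_mono)
    also have "\<dots> = ennreal (d x y + d y z + e)"
      using nn \<open>e > 0\<close> by (subst ennreal_plus[symmetric]) auto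
    finally show "d x z \<le> d x y + d y z + e"
      using C1_path_join[OF 1(1) 2(1)] 1 2 nn \<open>e > 0\<close>
      by (intro dist_le_length[of "\<gamma>\<^sub>1 +++ \<gamma>\<^sub>2"]) (auto simp: joinpaths_def)
  qed
qed

sublocale M: Metric_space E d
  by (rule metric)

lemma complete_metric_iff: "complete_metric (top_of_set E) atlas h \<longleftrightarrow> M.mcomplete"
  by (simp add: complete_metric_def)

text \<open>The hypothesis is a condition on the base alone. It confines the projections of the tail
  of a Cauchy sequence to a compact set, so a subsequence has projections converging to some \<open>s\<close>.
  Compactness is not available upstairs, where the fibre may be infinite; instead the Cauchy property
  keeps the tail in a single sheet over a disc around \<open>s\<close>, and the point of this sheet over \<open>s\<close> is
  the limit.\<close>

theorem complete_if_unit_balls_bounded: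
  assumes K: "\<And>a. a \<in> S \<Longrightarrow> \<exists>K. compact K \<and> K \<subseteq> S \<and>
    (\<forall>w. valid_path w \<and> path_image w \<subseteq> S \<and> w 0 = a \<and> conformal_length \<rho> w \<le> 1 \<longrightarrow> w 1 \<in> K)"
  shows "complete_metric (top_of_set E) atlas h"
  unfolding complete_metric_iff M.mcomplete_def
proof (intro allI impI)
  fix \<sigma> assume \<sigma>: "M.MCauchy \<sigma>"
  have \<sigma>E: "\<sigma> n \<in> E" for n
    using \<sigma> by (auto simp: M.MCauchy_def)
  have cauchy: "\<exists>N. \<forall>n n'. N \<le> n \<longrightarrow> N \<le> n' \<longrightarrow> d (\<sigma> n) (\<sigma> n') < e" if "e > 0" for e
    using \<sigma> that by (auto simp: M.MCauchy_def)
  obtain N\<^sub>0 where N\<^sub>0: "\<And>n n'. N\<^sub>0 \<le> n \<Longrightarrow> N\<^sub>0 \<le> n' \<Longrightarrow> d (\<sigma> n) (\<sigma> n') < 1"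
    using cauchy[of 1] by auto
  obtain K where K: "compact K" "K \<subseteq> S"
    "\<And>w. valid_path w \<Longrightarrow> path_image w \<subseteq> S \<Longrightarrow> w 0 = p (\<sigma> N\<^sub>0) \<Longrightarrow> conformal_length \<rho> w \<le> 1 \<Longrightarrow> w 1 \<in> K"
    using assms[OF p_in[OF \<sigma>E[of N\<^sub>0]]] by metis
  have inK: "p (\<sigma> (N\<^sub>0 + n)) \<in> K" for n
  proof -
    obtain \<gamma> where \<gamma>: "C1_path \<gamma>" "\<gamma> 0 = \<sigma> N\<^sub>0" "\<gamma> 1 = \<sigma> (N\<^sub>0 + n)" "len \<gamma> < ennreal 1"
      using near_optimal_path[OF \<sigma>E \<sigma>E N\<^sub>0[of N\<^sub>0 "N\<^sub>0 + n"]] by auto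
    then show ?thesis
      using K(3)[of "p \<circ> \<gamma>"] path_length_eq[of \<gamma>] path_image_p[of \<gamma>]
      by (auto simp: piecewise_C1_path_iff)
  qed
  obtain s r where s: "s \<in> K" "strict_mono r" "((\<lambda>n. p (\<sigma> (N\<^sub>0 + n))) \<circ> r) \<longlonglongrightarrow> s"
    using K(1) inK unfolding compact_def by metis
  define r' where "r' n = N\<^sub>0 + r n" for n
  have r': "strict_mono r'"
    using s(2) by (simp add: r'_def strict_mono_def)
  have lim: "(\<lambda>n. p (\<sigma> (r' n))) \<longlonglongrightarrow> s"
    using s(3) by (simp add: r'_def o_def)
  have "s \<in> S" using s K by blast
  then obtain R where R: "0 < R" "cball s R \<subseteq> S"
      "\<And>x. x \<in> E \<Longrightarrow> p x \<in> ball s R \<Longrightarrow> \<exists>u. x \<in> u \<and> sheet u s R"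
    using evenly_covered_balls by (metis order_refl)
  obtain c M where c: "0 < c" "0 \<le> M" "\<And>z. z \<in> cball s R \<Longrightarrow> c \<le> \<rho> z \<and> \<rho> z \<le> M"
    using \<rho>_bounds[OF R(2,1)] by blast
  obtain N\<^sub>1 where N\<^sub>1: "\<And>n. n \<ge> N\<^sub>1 \<Longrightarrow> dist (p (\<sigma> (r' n))) s < R / 2"
    using metric_LIMSEQ_D[OF lim, of "R/2"] R(1) by auto
  \<comment> \<open>A point whose projection is closer than \<open>R / 2\<close> to \<open>s\<close> has at least this distance from the complement of its sheet over the disc of radius \<open>R\<close>.\<close>
  have "c * (R / 2) > 0"
    using c R by simp
  then obtain N\<^sub>2 where N\<^sub>2: "\<And>n n'. N\<^sub>2 \<le> n \<Longrightarrow> N\<^sub>2 \<le> n' \<Longrightarrow> d (\<sigma> n) (\<sigma> n') < c * (R / 2)"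
    using cauchy by meson
  define N where "N = max N\<^sub>1 N\<^sub>2"
  have ge: "N\<^sub>1 \<le> n" "N\<^sub>2 \<le> r' n" if "N \<le> n" for n
    using that seq_suble[OF r', of n] by (auto simp: N_def)
  have "p (\<sigma> (r' N)) \<in> ball s R"
    using N\<^sub>1[of N] ge[of N] R(1) by (simp add: dist_commute)
  then obtain u where u: "\<sigma> (r' N) \<in> u" "sheet u s R"
    using R(3)[OF \<sigma>E] by blast
  have in_u: "\<sigma> (r' n) \<in> u" if "n \<ge> N" for n
  proof (rule stays_in_sheet[OF u(2) _ _ u(1) \<sigma>E])
    have "d (\<sigma> (r' N)) (\<sigma> (r' n)) < c * (R / 2)"
      using N\<^sub>2 ge that by auto
    also have "\<dots> \<le> c * (R - dist s (p (\<sigma> (r' N))))"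
      using N\<^sub>1[of N] ge[of N] c(1) by (intro mult_left_mono) (auto simp: dist_commute)
    finally show "d (\<sigma> (r' N)) (\<sigma> (r' n)) < c * (R - dist s (p (\<sigma> (r' N))))" .
  qed (use c in auto)
  obtain q where q: "homeomorphism u (ball s R) p q"
    using u by (auto simp: sheet_def)
  have x: "q s \<in> u" "p (q s) = s"
    using q R(1) by (auto simp: homeomorphism_def)
  then have xE: "q s \<in> E"
    using u by (auto simp: sheet_def)
  have bound: "d (\<sigma> (r' n)) (q s) \<le> M * dist (p (\<sigma> (r' n))) s" if "n \<ge> N" for n
  proof -
    have "closed_segment (p (\<sigma> (r' n))) s \<subseteq> ball s R"
      using in_u[OF that] u R(1) by (intro closed_segment_subset convex_ball) (auto simp: sheet_def)
    then have "\<rho> z \<le> M" if "z \<in> closed_segment (p (\<sigma> (r' n))) s" for z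
      using c(3) that by auto
    then show ?thesis
      using dist_in_sheet_le[OF u(2) in_u[OF that] x(1) c(2)] x(2) by simp
  qed
  have "(\<lambda>n. M * dist (p (\<sigma> (r' n))) s) \<longlonglongrightarrow> M * 0"
    using lim by (intro tendsto_intros tendsto_dist_iff[THEN iffD1])
  moreover have "\<forall>\<^sub>F n in sequentially. norm (d (\<sigma> (r' n)) (q s)) \<le> M * dist (p (\<sigma> (r' n))) s"
    using bound M.nonneg unfolding eventually_sequentially real_norm_def by (metis abs_of_nonneg)
  ultimately have "(\<lambda>n. d (\<sigma> (r' n)) (q s)) \<longlonglongrightarrow> 0"
    using Lim_null_comparison[of "\<lambda>n. d (\<sigma> (r' n)) (q s)"] by (simp only: mult_zero_right)
  then have "limitin M.mtopology (\<sigma> \<circ> r') (q s) sequentially"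
    using xE \<sigma>E by (simp add: M.limitin_metric_dist_null o_def)
  then show "\<exists>x. limitin M.mtopology \<sigma> x sequentially"
    using M.MCauchy_convergent_subsequence[OF \<sigma> r'] by blast
qed

text \<open>Convergence for the distance of the covering forces convergence of the projections, because the
  sheets over discs around \<open>p x\<close> contain small balls of the distance around \<open>x\<close>.\<close>

lemma limitin_base:
  assumes "limitin M.mtopology \<sigma> x sequentially"
  shows "(\<lambda>n. p (\<sigma> n)) \<longlonglongrightarrow> p x"
proof (rule metric_LIMSEQ_I)
  fix e :: real assume e: "0 < e"
  have x: "x \<in> E" and lim: "\<And>\<epsilon>. \<epsilon> > 0 \<Longrightarrow> \<exists>N. \<forall>n\<ge>N. \<sigma> n \<in> E \<and> d (\<sigma> n) x < \<epsilon>"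
    using assms unfolding M.limitin_metric eventually_sequentially by blast+
  obtain R where R: "0 < R" "cball (p x) R \<subseteq> S"
      "\<And>r. 0 < r \<Longrightarrow> r \<le> R \<Longrightarrow> \<exists>u. x \<in> u \<and> sheet u (p x) r"
    using evenly_covered_balls[OF p_in[OF x]] x by (metis centre_in_ball)
  define r where "r = min R e"
  have r: "0 < r" "r \<le> R" "r \<le> e"
    using R e by (auto simp: r_def)
  obtain u where u: "x \<in> u" "sheet u (p x) r"
    using R(3) r by blast
  obtain c M where c: "0 < c" "\<And>z. z \<in> cball (p x) R \<Longrightarrow> c \<le> \<rho> z \<and> \<rho> z \<le> M"
    using \<rho>_bounds[OF R(2,1)] by metis
  obtain N where N: "\<And>n. n \<ge> N \<Longrightarrow> \<sigma> n \<in> E \<and> d (\<sigma> n) x < c * r"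
    using lim[of "c * r"] c r by auto
  have "dist (p (\<sigma> n)) (p x) < e" if "n \<ge> N" for n
  proof -
    have "d x (\<sigma> n) < c * r"
      using N[OF that] d_commute by metis
    moreover have "c \<le> \<rho> z" if "z \<in> ball (p x) r" for z
      using c(2)[of z] that r(2) by simp
    ultimately have "\<sigma> n \<in> u"
      using stays_in_sheet[OF u(2) _ _ u(1), of c "\<sigma> n"] N[OF that] c(1) by simp
    then have "p (\<sigma> n) \<in> ball (p x) r"
      using u(2) unfolding sheet_def by blast
    then show ?thesis
      using r(3) by (simp add: dist_commute)
  qed
  then show "\<exists>N. \<forall>n\<ge>N. dist (p (\<sigma> n)) (p x) < e"
    by blast
qed

text \<open>The ray is lifted in unit steps, which gives a sequence over the points \<open>T + n\<close>. On a piece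
  \<open>[a, b]\<close> of the ray the density is at most \<open>C / a\<^sup>2\<close>, so for \<open>b \<le> 2 a\<close> its length is at most
  \<open>C (b - a) / a\<^sup>2 \<le> 2 C (1 / a - 1 / b)\<close>. This bound is additive in the intervals, which both makes
  the distances telescope and allows the lift to be pieced together from local lifts by Bolzano
  induction on intervals.\<close>

theorem incomplete_if_short_ray:
  assumes T: "0 < T" and C: "0 < C"
    and ray: "\<And>t. T \<le> t \<Longrightarrow> complex_of_real t \<in> S \<and> \<rho> (complex_of_real t) \<le> C / t\<^sup>2"
  shows "\<not> complete_metric (top_of_set E) atlas h"
proof
  assume complete: "complete_metric (top_of_set E) atlas h"
  have lift: "\<forall>x\<in>E. p x = complex_of_real a \<longrightarrow>
      (\<exists>y\<in>E. p y = complex_of_real b \<and> d x y \<le> 2 * C * (1 / a - 1 / b))"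
    if "T \<le> a" "a \<le> b" for a b
  proof -
    define P where "P = (\<lambda>a b. T \<le> a \<longrightarrow> (\<forall>x\<in>E. p x = complex_of_real a \<longrightarrow>
      (\<exists>y\<in>E. p y = complex_of_real b \<and> d x y \<le> 2 * C * (1 / a - 1 / b))))"
    from \<open>a \<le> b\<close> have "P a b"
    proof (induction rule: Bolzano)
      case (trans a b c)
      show ?case
        unfolding P_def
      proof (intro impI ballI)
        fix x assume x: "T \<le> a" "x \<in> E" "p x = complex_of_real a"
        obtain y where y: "y \<in> E" "p y = complex_of_real b" "d x y \<le> 2 * C * (1 / a - 1 / b)"
          using trans(1) x unfolding P_def by blast
        obtain z where z: "z \<in> E" "p z = complex_of_real c" "d y z \<le> 2 * C * (1 / b - 1 / c)"
          using trans(2) \<open>a \<le> b\<close> x(1) y unfolding P_def by force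
        have "d x z \<le> 2 * C * (1 / a - 1 / b) + 2 * C * (1 / b - 1 / c)"
          using M.triangle[OF x(2) y(1) z(1)] y z by simp
        also have "\<dots> = 2 * C * (1 / a - 1 / c)"
          by (simp add: algebra_simps)
        finally show "\<exists>y\<in>E. p y = complex_of_real c \<and> d x y \<le> 2 * C * (1 / a - 1 / c)"
          using z by blast
      qed
    next
      case (local t)
      then have "complex_of_real t \<in> S"
        using ray[of t] \<open>T \<le> a\<close> by simp
      then obtain R where R: "0 < R"
          "\<And>x. x \<in> E \<Longrightarrow> p x \<in> ball (complex_of_real t) R \<Longrightarrow> \<exists>u. x \<in> u \<and> sheet u (complex_of_real t) R"
        using evenly_covered_balls by (metis order_refl)
      \<comment> \<open>\<open>b' - a' < R\<close> keeps the piece in an evenly covered disc, and \<open>b' - a' < T \<le> a'\<close> gives \<open>b' \<le> 2 a'\<close>.\<close>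
      have "P a' b'" if ab: "a' \<le> t" "t \<le> b'" "b' - a' < min R T" for a' b'
        unfolding P_def
      proof (intro impI ballI)
        fix x assume x: "T \<le> a'" "x \<in> E" "p x = complex_of_real a'"
        have *: "complex_of_real a' \<in> ball (complex_of_real t) R" "complex_of_real b' \<in> ball (complex_of_real t) R"
          using ab by (auto simp: dist_norm simp flip: of_real_diff)
        then obtain u where u: "x \<in> u" "sheet u (complex_of_real t) R"
          using R(2)[OF x(2)] x(3) by auto
        then obtain q where q: "homeomorphism u (ball (complex_of_real t) R) p q"
          by (auto simp: sheet_def)
        define y where "y = q (complex_of_real b')"
        have y: "y \<in> u" "p y = complex_of_real b'"
          using q * by (auto simp: homeomorphism_def y_def)
        have "d x y \<le> C / a'\<^sup>2 * dist (p x) (p y)"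
        proof (rule dist_in_sheet_le[OF u(2,1) y(1)])
          fix z assume "z \<in> closed_segment (p x) (p y)"
          then obtain t' where t': "z = complex_of_real t'" "a' \<le> t'"
            using x(3) y(2) ab by (auto simp: closed_segment_of_real closed_segment_eq_real_ivl)
          have "\<rho> z \<le> C / t'\<^sup>2"
            using ray[of t'] t' x(1) by simp
          also have "\<dots> \<le> C / a'\<^sup>2"
            using t' x(1) T C by (intro divide_left_mono power_mono) auto
          finally show "\<rho> z \<le> C / a'\<^sup>2" .
        qed (use C in auto)
        also have "dist (p x) (p y) = b' - a'"
          using x y ab by (simp add: dist_norm flip: of_real_diff)
        also have "C / a'\<^sup>2 * (b' - a') \<le> 2 * C * (1 / a' - 1 / b')"
        proof -
          have pos: "0 < a'" "0 < b'" "b' \<le> 2 * a'"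
            using ab x(1) T by auto
          have "C / a'\<^sup>2 * (b' - a') * (a'\<^sup>2 * b') = C * (b' - a') * b'"
            using pos by simp
          also have "\<dots> \<le> C * (b' - a') * (2 * a')"
            using pos C ab by (intro mult_left_mono) auto
          also have "\<dots> = 2 * C * (1 / a' - 1 / b') * (a'\<^sup>2 * b')"
            using pos by (simp add: field_simps power2_eq_square)
          finally show ?thesis
            by (rule mult_right_le_imp_le) (use pos in simp)
        qed
        finally show "\<exists>y\<in>E. p y = complex_of_real b' \<and> d x y \<le> 2 * C * (1 / a' - 1 / b')"
          using y u by (auto simp: sheet_def)
      qed
      then show ?case
        using R T by (intro exI[of _ "min R T"]) auto
    qed
    then show ?thesis
      using \<open>T \<le> a\<close> by (simp add: P_def)
  qed
  have start: "\<exists>x. x \<in> E \<and> p x = complex_of_real (T + real 0)"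
    using ray[of T] p_image by force
  have "\<exists>\<sigma>. \<forall>n. (\<sigma> n \<in> E \<and> p (\<sigma> n) = complex_of_real (T + real n)) \<and>
      d (\<sigma> n) (\<sigma> (Suc n)) \<le> 2 * C * (1 / (T + real n) - 1 / (T + real (Suc n)))"
  proof (rule dependent_nat_choice)
    fix x n assume "x \<in> E \<and> p x = complex_of_real (T + real n)"
    then show "\<exists>y. (y \<in> E \<and> p y = complex_of_real (T + real (Suc n))) \<and>
        d x y \<le> 2 * C * (1 / (T + real n) - 1 / (T + real (Suc n)))"
      using lift[of "T + real n" "T + real (Suc n)"] by force
  qed (rule start)
  then obtain \<sigma> where \<sigma>: "\<And>n. \<sigma> n \<in> E" "\<And>n. p (\<sigma> n) = complex_of_real (T + real n)"
     and step: "\<And>n. d (\<sigma> n) (\<sigma> (Suc n)) \<le> 2 * C * (1 / (T + real n) - 1 / (T + real (Suc n)))"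
    by blast
  have tele: "d (\<sigma> j) (\<sigma> (j + k)) \<le> 2 * C * (1 / (T + real j) - 1 / (T + real (j + k)))" for j k
  proof (induction k)
    case 0
    then show ?case
      using \<sigma>(1) by simp
  next
    case (Suc k)
    have "d (\<sigma> j) (\<sigma> (j + Suc k)) \<le> d (\<sigma> j) (\<sigma> (j + k)) + d (\<sigma> (j + k)) (\<sigma> (Suc (j + k)))"
      using M.triangle[OF \<sigma>(1) \<sigma>(1) \<sigma>(1)] by simp
    also have "\<dots> \<le> 2 * C * (1 / (T + real j) - 1 / (T + real (j + Suc k)))"
      using Suc step[of "j + k"] by (simp add: algebra_simps)
    finally show ?case .
  qed
  have le: "d (\<sigma> j) (\<sigma> k) \<le> 2 * C / (T + real j)" if "j \<le> k" for j k
  proof -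
    have "d (\<sigma> j) (\<sigma> k) \<le> 2 * C * (1 / (T + real j) - 1 / (T + real k))"
      using tele[of j "k - j"] that by simp
    also have "\<dots> \<le> 2 * C * (1 / (T + real j))"
      using T C by (intro mult_left_mono) auto
    finally show ?thesis by simp
  qed
  have "M.MCauchy \<sigma>"
    unfolding M.MCauchy_def
  proof (intro conjI allI impI)
    fix e :: real assume "0 < e"
    obtain N where N: "2 * C / e < real N"
      using reals_Archimedean2 by blast
    have small: "d (\<sigma> j) (\<sigma> k) < e" if "N \<le> j" "j \<le> k" for j k
    proof -
      have "2 * C / e < T + real j"
        using N T that(1) by linarith
      then have "2 * C / (T + real j) < e"
        using T \<open>0 < e\<close> by (simp add: field_simps)
      then show ?thesis
        using le[OF that(2)] by simp
    qed
    show "\<exists>N. \<forall>n n'. N \<le> n \<longrightarrow> N \<le> n' \<longrightarrow> d (\<sigma> n) (\<sigma> n') < e"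
      using small d_commute by (intro exI[of _ N]) (metis nat_le_linear)
  qed (use \<sigma> in auto)
  then obtain x where "limitin M.mtopology \<sigma> x sequentially"
    using complete unfolding complete_metric_iff M.mcomplete_def by blast
  then have "(\<lambda>n. norm (p (\<sigma> n))) \<longlonglongrightarrow> norm (p x)"
    by (intro tendsto_norm limitin_base)
  moreover have "norm (p (\<sigma> n)) = T + real n" for n
    using T \<sigma>(2) by (simp del: of_real_add)
  ultimately have "(\<lambda>n. T + real n - T) \<longlonglongrightarrow> norm (p x) - T"
    by (intro tendsto_diff tendsto_const) simp
  then have "(\<lambda>n. real n) \<longlonglongrightarrow> norm (p x) - T"
    by simp
  then show False
    using not_tendsto_and_filterlim_at_infinity[OF _ _ filterlim_at_top_imp_at_infinity[OF filterlim_real_sequentially]]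
    by simp
qed

end

section \<open>The metric of the punctured plane and of its coverings\<close>

lemma simply_connected_imp_connected_space:
  fixes E :: "'a::topological_space set"
  assumes "simply_connected E"
  shows "connected E"
proof (rule path_connected_imp_connected)
  have "path_component E a b" if ab: "a \<in> E" "b \<in> E" for a b
  proof -
    have "homotopic_loops E (\<lambda>_. a) (\<lambda>_. b)"
      using ab by (intro assms[unfolded simply_connected_def, rule_format])
        (auto simp: path_def path_image_def pathfinish_def pathstart_def)
    then show ?thesis
      using homotopic_loops_imp_path_component_value[of E "\<lambda>_. a" "\<lambda>_. b" 0] by simp
  qed
  then show "path_connected E"
    by (simp add: path_connected_component)
qed

text \<open>The density \<open>\<rho>\<close>: the square root of the coefficient of \<open>ds\<^sup>2\<close> in the coordinate \<open>z\<close>.\<close>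

definition weight :: "nat \<Rightarrow> nat \<Rightarrow> (nat \<Rightarrow> complex) \<Rightarrow> complex \<Rightarrow> real" where
  "weight m q \<alpha> z = sqrt (1 + (cmod z)\<^sup>2) ^ m / (\<Prod>i=1..q-1. cmod (z - \<alpha> i))"

lemma sqrt_power_squared: "(sqrt (1 + r\<^sup>2) ^ m)\<^sup>2 = (1 + r\<^sup>2) ^ m"
  by (metis power_mult mult.commute real_sqrt_pow2 add_nonneg_nonneg zero_le_one zero_le_power2)

lemma punctured_plane_iff: "z \<in> punctured_plane q \<alpha> \<longleftrightarrow> (\<forall>i\<in>{1..q-1}. z \<noteq> \<alpha> i)"
  by (auto simp: punctured_plane_def)

lemma open_punctured_plane: "open (punctured_plane q \<alpha>)"
  unfolding punctured_plane_def by (intro open_Compl finite_imp_closed) auto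

lemma connected_punctured_plane: "connected (punctured_plane q \<alpha>)"
  unfolding punctured_plane_def
  by (intro path_connected_imp_connected path_connected_complement_countable) (auto simp: countable_finite)

lemma norm_le_sqrt_one_plus: "cmod (z - a) \<le> (1 + cmod a) * sqrt (1 + (cmod z)\<^sup>2)"
proof -
  have "cmod z \<le> sqrt (1 + (cmod z)\<^sup>2)" "1 \<le> sqrt (1 + (cmod z)\<^sup>2)"
    by (simp_all add: real_le_rsqrt)
  moreover from this have "cmod a * 1 \<le> cmod a * sqrt (1 + (cmod z)\<^sup>2)"
    by (intro mult_left_mono) auto
  ultimately show ?thesis
    using norm_triangle_ineq4[of z a] by (simp add: algebra_simps)
qed

lemma weight_pos: "z \<in> punctured_plane q \<alpha> \<Longrightarrow> 0 < weight m q \<alpha> z"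
  unfolding weight_def punctured_plane_iff
  by (intro divide_pos_pos zero_less_power prod_pos) (auto simp: add_pos_nonneg)

lemma continuous_on_weight: "continuous_on (punctured_plane q \<alpha>) (weight m q \<alpha>)"
  unfolding weight_def by (intro continuous_intros) (auto simp: punctured_plane_iff)

text \<open>This is where \<open>q \<le> m + 2\<close> enters. Each of the \<open>q - 2\<close> factors \<open>|z - \<alpha>\<^sub>j|\<close> with \<open>j \<noteq> i\<close> is at
  most \<open>(1 + |\<alpha>\<^sub>j|) (1 + |z|\<^sup>2)\<^bsup>1/2\<^esup>\<close>, and the numerator provides \<open>m \<ge> q - 2\<close> of these square
  roots.\<close>

lemma inverse_dist_le_weight:
  assumes q: "q \<le> m + 2" and i: "i \<in> {1..q-1}" and z: "z \<in> punctured_plane q \<alpha>"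
  shows "1 / cmod (z - \<alpha> i) \<le> (\<Prod>j\<in>{1..q-1} - {i}. 1 + cmod (\<alpha> j)) * weight m q \<alpha> z"
proof -
  define r where "r = sqrt (1 + (cmod z)\<^sup>2)"
  have r: "r \<ge> 1" by (simp add: r_def)
  let ?J = "{1..q-1} - {i}"
  have ne: "cmod (z - \<alpha> j) > 0" if "j \<in> {1..q-1}" for j
    using z that by (auto simp: punctured_plane_iff)
  have "(\<Prod>j\<in>?J. cmod (z - \<alpha> j)) \<le> (\<Prod>j\<in>?J. (1 + cmod (\<alpha> j)) * r)"
    by (intro prod_mono) (auto simp: r_def norm_le_sqrt_one_plus)
  also have "\<dots> = (\<Prod>j\<in>?J. 1 + cmod (\<alpha> j)) * r ^ card ?J"
    by (simp add: prod.distrib)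
  also have "\<dots> \<le> (\<Prod>j\<in>?J. 1 + cmod (\<alpha> j)) * r ^ m"
    using r q i by (intro mult_left_mono power_increasing prod_nonneg) auto
  finally have "(\<Prod>j\<in>?J. cmod (z - \<alpha> j)) \<le> (\<Prod>j\<in>?J. 1 + cmod (\<alpha> j)) * r ^ m" .
  moreover have "weight m q \<alpha> z = r ^ m / (cmod (z - \<alpha> i) * (\<Prod>j\<in>?J. cmod (z - \<alpha> j)))"
    using prod.remove[of "{1..q-1}" i "\<lambda>j. cmod (z - \<alpha> j)"] i by (simp add: weight_def r_def)
  moreover have "(\<Prod>j\<in>?J. cmod (z - \<alpha> j)) > 0"
    using ne by (intro prod_pos) auto
  ultimately show ?thesis
    using ne[OF i] by (simp add: field_simps)
qed

text \<open>Beyond twice the moduli of the punctures each of the \<open>q - 1\<close> factors in the denominator is at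
  least \<open>t / 2\<close>, while the numerator is at most \<open>(2 t)\<^sup>m\<close>; and \<open>m - (q - 1) \<le> -2\<close>.\<close>

lemma weight_le_inverse_square:
  assumes q: "m + 2 < q" and t: "2 * (\<Sum>i=1..q-1. cmod (\<alpha> i)) + 1 \<le> t"
  shows "complex_of_real t \<in> punctured_plane q \<alpha>"
    and "weight m q \<alpha> (complex_of_real t) \<le> 2 ^ (m + (q - 1)) / t\<^sup>2"
proof -
  have s: "0 \<le> (\<Sum>i=1..q-1. cmod (\<alpha> i))"
    by (intro sum_nonneg) auto
  have t1: "t \<ge> 1" using t s by linarith
  have far: "t / 2 \<le> cmod (complex_of_real t - \<alpha> i)" if "i \<in> {1..q-1}" for i
  proof -
    have "cmod (\<alpha> i) \<le> (\<Sum>i=1..q-1. cmod (\<alpha> i))"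
      using that by (intro member_le_sum) auto
    moreover have "cmod (complex_of_real t) - cmod (\<alpha> i) \<le> cmod (complex_of_real t - \<alpha> i)"
      by (rule norm_triangle_ineq2)
    ultimately show ?thesis
      using t t1 by simp
  qed
  then show "complex_of_real t \<in> punctured_plane q \<alpha>"
    using t1 by (force simp: punctured_plane_iff)
  have "(t/2) ^ (q-1) = (\<Prod>i=1..q-1. t/2)"
    by simp
  also have "\<dots> \<le> (\<Prod>i=1..q-1. cmod (complex_of_real t - \<alpha> i))"
    using far t1 by (intro prod_mono) auto
  finally have den: "(t/2) ^ (q-1) \<le> (\<Prod>i=1..q-1. cmod (complex_of_real t - \<alpha> i))" .
  have "sqrt (1 + t\<^sup>2) \<le> 2 * t"
    using t1 by (intro real_le_lsqrt) (auto simp: power2_eq_square algebra_simps intro: mult_mono[of 1 t 1 t, simplified] order_trans)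
  then have "weight m q \<alpha> (complex_of_real t) \<le> (2 * t) ^ m / (t/2) ^ (q-1)"
    unfolding weight_def using den t1 by (intro frac_le power_mono) auto
  also have "\<dots> = 2 ^ (m + (q - 1)) * t ^ m / t ^ (q-1)"
    using t1 by (simp add: power_divide power_mult_distrib power_add)
  also have "\<dots> \<le> 2 ^ (m + (q - 1)) / t\<^sup>2"
  proof -
    have "t ^ m * t\<^sup>2 = t ^ (m + 2)"
      by (simp only: power_add)
    also have "\<dots> \<le> t ^ (q-1)"
      using t1 q by (intro power_increasing) auto
    finally have "t ^ m * t\<^sup>2 \<le> t ^ (q-1)" .
    then show ?thesis
      using t1 by (simp add: divide_le_eq le_divide_eq mult.assoc)
  qed
  finally show "weight m q \<alpha> (complex_of_real t) \<le> 2 ^ (m + (q - 1)) / t\<^sup>2" .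
qed

lemma has_derivative_ln_dist:
  fixes a z :: complex
  assumes "z \<noteq> a"
  shows "((\<lambda>z. ln (cmod (z - a))) has_derivative (\<lambda>v. (v \<bullet> sgn (z - a)) / cmod (z - a))) (at z)"
proof -
  have "((\<lambda>z. cmod (z - a)) has_derivative (\<lambda>v. v \<bullet> sgn (z - a))) (at z)"
    using assms by (intro has_derivative_compose[of "\<lambda>z. z - a" "\<lambda>v. v", OF _ has_derivative_norm])
      (auto intro!: derivative_eq_intros)
  then show ?thesis
    using assms by (auto intro!: derivative_eq_intros simp: divide_inverse)
qed

lemma differential_pullback_chart:
  assumes "open (p ` U)" "inj_on p U" "x \<in> U"
  shows "differential p (U, p) x = 1"
proof -
  have "((p \<circ> inv_into U p) has_field_derivative 1) (at (p x))"
    by (rule has_field_derivative_transform_within_open[OF DERIV_ident assms(1)])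
      (use assms in \<open>auto simp: f_inv_into_f\<close>)
  then show ?thesis
    by (simp add: differential_def DERIV_imp_deriv)
qed

lemma ds2_eq_weight:
  assumes "open (p ` U)" "inj_on p U" "x \<in> U"
  shows "ds2 X m (\<lambda>x. Some (p x)) (omega_form q \<alpha> p) (U, p) x = (weight m q \<alpha> (p x))\<^sup>2"
  using differential_pullback_chart[OF assms] sqrt_power_squared
  by (simp add: ds2_def omega_form_def weight_def norm_divide power_divide flip: prod_norm)

text \<open>Completeness is decided in the base, by the behaviour of \<open>\<rho>\<close> near the punctures and near
  infinity; it is therefore the same for all connected coverings.\<close>

lemma complete_cover_iff:
  fixes E :: "'a::topological_space set"
  assumes "q \<ge> 2" and cover: "covering_space E p (punctured_plane q \<alpha>)" and "connected E"
  shows "complete_metric (top_of_set E) (pullback_atlas (top_of_set E) p)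
      (ds2 (top_of_set E) m (\<lambda>x. Some (p x)) (omega_form q \<alpha> p)) \<longleftrightarrow> q \<le> m + 2"
proof -
  define h where "h = ds2 (top_of_set E) m (\<lambda>x. Some (p x)) (omega_form q \<alpha> p)"
  interpret conformal_cover E p "punctured_plane q \<alpha>" "weight m q \<alpha>" h
  proof
    fix c x assume c: "c \<in> pullback_atlas (top_of_set E) p" "x \<in> fst c"
    then obtain U where U: "c = (U, p)" "open (p ` U)" "inj_on p U"
      by (elim pullback_atlasE)
    then show "h c x = (weight m q \<alpha> (p x))\<^sup>2"
      using c U ds2_eq_weight by (simp add: h_def)
  qed (use assms open_punctured_plane continuous_on_weight weight_pos in auto)
  have "complete_metric (top_of_set E) atlas h" if q: "q \<le> m + 2"
  proof (rule complete_if_unit_balls_bounded)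
    fix a assume a: "a \<in> punctured_plane q \<alpha>"
    define B where "B i = (\<Prod>j\<in>{1..q-1} - {i}. 1 + cmod (\<alpha> j))" for i
    have B: "B i > 0" for i
      unfolding B_def by (intro prod_pos) (auto simp: add_pos_nonneg)
    \<comment> \<open>The bounds on \<open>|z - \<alpha>\<^sub>i|\<close> that result when \<open>ln |z - \<alpha>\<^sub>i|\<close> changes by at most \<open>B i\<close>. As there is at least one puncture, \<open>K\<close> is bounded.\<close>
    define K where "K = (\<Inter>i\<in>{1..q-1}. {z. exp (- B i) * cmod (a - \<alpha> i) \<le> cmod (z - \<alpha> i) \<and>
        cmod (z - \<alpha> i) \<le> exp (B i) * cmod (a - \<alpha> i)})"
    have "closed K"
      unfolding K_def by (intro closed_INT ballI closed_Collect_conj closed_Collect_le continuous_intros)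
    moreover have "K \<subseteq> cball (\<alpha> 1) (exp (B 1) * cmod (a - \<alpha> 1))"
      using \<open>q \<ge> 2\<close> by (force simp: K_def dist_norm norm_minus_commute)
    then have "bounded K"
      using bounded_cball bounded_subset by blast
    ultimately have "compact K"
      by (simp add: compact_eq_bounded_closed)
    moreover have "K \<subseteq> punctured_plane q \<alpha>"
    proof
      fix z assume z: "z \<in> K"
      have "z \<noteq> \<alpha> i" if i: "i \<in> {1..q-1}" for i
      proof -
        have "0 < exp (- B i) * cmod (a - \<alpha> i)"
          using a i by (auto simp: punctured_plane_iff)
        also have "\<dots> \<le> cmod (z - \<alpha> i)"
          using z i by (auto simp: K_def)
        finally show ?thesis by auto
      qed
      then show "z \<in> punctured_plane q \<alpha>"
        by (simp add: punctured_plane_iff)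
    qed
    moreover have "w 1 \<in> K"
      if w: "valid_path w" "path_image w \<subseteq> punctured_plane q \<alpha>" "w 0 = a"
        "conformal_length (weight m q \<alpha>) w \<le> 1" for w
      unfolding K_def
    proof (rule INT_I, rule CollectI)
      fix i assume i: "i \<in> {1..q-1}"
      define F where "F z = ln (cmod (z - \<alpha> i)) / B i" for z
      define F' where "F' z v = (v \<bullet> sgn (z - \<alpha> i)) / cmod (z - \<alpha> i) / B i" for z v
      have ne: "z \<noteq> \<alpha> i" if "z \<in> punctured_plane q \<alpha>" for z
        using that i by (auto simp: punctured_plane_iff)
      have "ennreal (norm (F (w 1) - F (w 0))) \<le> conformal_length (weight m q \<alpha>) w"
      proof (rule conformal_length_ge[OF w(1,2) continuous_on_weight weight_pos, where F' = F' and
            D = "punctured_plane q \<alpha>"])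
        show der: "(F has_derivative F' z) (at z)" if "z \<in> punctured_plane q \<alpha>" for z
          unfolding F_def F'_def
          by (rule bounded_linear.has_derivative[OF bounded_linear_divide has_derivative_ln_dist[OF ne[OF that]]])
        then show "continuous_on (punctured_plane q \<alpha>) F"
          using has_derivative_continuous continuous_at_imp_continuous_on by blast
        fix z v assume z: "z \<in> punctured_plane q \<alpha>"
        have "norm (F' z v) \<le> norm v / cmod (z - \<alpha> i) / B i"
          using Cauchy_Schwarz_ineq2[of v "sgn (z - \<alpha> i)"] ne[OF z] B[of i]
          by (auto simp: F'_def norm_sgn abs_mult intro!: divide_right_mono)
        also have "\<dots> = norm v * (1 / cmod (z - \<alpha> i)) / B i"
          by simp
        also have "\<dots> \<le> norm v * (B i * weight m q \<alpha> z) / B i"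
          using inverse_dist_le_weight[OF q i z] B[of i] unfolding B_def
          by (intro divide_right_mono mult_left_mono) (auto intro: less_imp_le)
        also have "\<dots> = weight m q \<alpha> z * norm v"
          using B[of i] by simp
        finally show "norm (F' z v) \<le> weight m q \<alpha> z * norm v" .
      qed (use w in \<open>auto simp: path_image_def image_subset_iff\<close>)
      also have "\<dots> \<le> ennreal 1"
        using w by simp
      finally have "\<bar>F (w 1) - F (w 0)\<bar> \<le> 1"
        by (simp del: ennreal_1)
      then have "\<bar>ln (cmod (w 1 - \<alpha> i)) - ln (cmod (a - \<alpha> i))\<bar> \<le> B i"
        using B[of i] w(3) by (simp add: F_def field_simps flip: diff_divide_distrib)
      then have ln: "ln (cmod (w 1 - \<alpha> i)) \<le> B i + ln (cmod (a - \<alpha> i))"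
          "- B i + ln (cmod (a - \<alpha> i)) \<le> ln (cmod (w 1 - \<alpha> i))"
        by linarith+
      have "w 1 \<in> punctured_plane q \<alpha>"
        using w(2) by (auto simp: path_image_def)
      then have pos: "0 < cmod (w 1 - \<alpha> i)" "0 < cmod (a - \<alpha> i)"
        using ne a by auto
      then show "exp (- B i) * cmod (a - \<alpha> i) \<le> cmod (w 1 - \<alpha> i) \<and>
          cmod (w 1 - \<alpha> i) \<le> exp (B i) * cmod (a - \<alpha> i)"
        using ln[THEN exp_mono] by (simp only: exp_add exp_ln)
    qed
    ultimately show "\<exists>K. compact K \<and> K \<subseteq> punctured_plane q \<alpha> \<and> (\<forall>w. valid_path w \<and>
        path_image w \<subseteq> punctured_plane q \<alpha> \<and> w 0 = a \<and> conformal_length (weight m q \<alpha>) w \<le> 1 \<longrightarrow> w 1 \<in> K)"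
      by blast
  qed
  moreover have "\<not> complete_metric (top_of_set E) atlas h" if q: "m + 2 < q"
  proof (rule incomplete_if_short_ray)
    show "0 < 2 * (\<Sum>i=1..q-1. cmod (\<alpha> i)) + 1"
      by (intro add_nonneg_pos mult_nonneg_nonneg sum_nonneg) auto
    show "(0::real) < 2 ^ (m + (q - 1))"
      by simp
  qed (use weight_le_inverse_square[OF q] in blast)
  ultimately show ?thesis
    unfolding h_def by (meson not_le)
qed

text \<open>The omitted values are the \<open>q - 1\<close> punctures and infinity.\<close>

lemma omits_finite_values:
  assumes "q \<ge> 2" "inj_on \<alpha> {1..q-1}" "z ` topspace X = punctured_plane q \<alpha>"
  shows "omits_distinct_values X (\<lambda>x. Some (z x)) q"
  unfolding omits_distinct_values_def
proof (intro exI conjI)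
  let ?W = "insert None (Some ` \<alpha> ` {1..q-1})"
  show "finite ?W" by simp
  have "card (Some ` \<alpha> ` {1..q-1}) = q - 1"
    using assms by (simp add: card_image)
  then show "card ?W = q"
    using assms by (subst card_insert_disjoint) auto
  show "\<forall>w\<in>?W. w \<notin> (\<lambda>x. Some (z x)) ` topspace X"
    using assms(3) by (auto simp: punctured_plane_def)
qed

section \<open>Plane domains as Riemann surfaces with smooth metrics\<close>

declare Ck_on.simps(2) [simp del]

text \<open>Smoothness is proved for each order by closure under the arithmetic operations, the partial
  derivatives of the result being arithmetic expressions in those of the operands. As such
  expressions also contain the operands themselves, \<open>Ck_on_pred\<close> is needed in each step.\<close>

lemma Ck_on_SucI:
  assumes "\<And>z. z \<in> S \<Longrightarrow> (f has_derivative (\<lambda>v. fx z * Re v + fy z * Im v)) (at z)"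
    and "Ck_on k fx S" "Ck_on k fy S"
  shows "Ck_on (Suc k) f S"
  unfolding Ck_on.simps using assms by blast

lemma Ck_on_pred: "Ck_on (Suc k) f S \<Longrightarrow> Ck_on k f S"
proof (induction k arbitrary: f)
  case 0
  then show ?case
    by (auto simp: Ck_on.simps intro!: continuous_at_imp_continuous_on dest: has_derivative_continuous)
next
  case (Suc k)
  then obtain fx fy where "\<And>z. z \<in> S \<Longrightarrow> (f has_derivative (\<lambda>v. fx z * Re v + fy z * Im v)) (at z)"
    "Ck_on (Suc k) fx S" "Ck_on (Suc k) fy S"
    unfolding Ck_on.simps(2)[of "Suc k"] by blast
  then show ?case
    using Suc.IH by (intro Ck_on_SucI[of S f fx fy]) auto
qed

lemma Ck_on_const: "Ck_on k (\<lambda>_. c) S"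
proof (induction k arbitrary: c)
  case (Suc k)
  show ?case
    by (rule Ck_on_SucI[of _ _ "\<lambda>_. 0" "\<lambda>_. 0"]) (auto intro: Suc)
qed simp

lemma Ck_on_Re: "Ck_on k Re S" and Ck_on_Im: "Ck_on k Im S"
proof -
  have "Ck_on k Re S \<and> Ck_on k Im S"
  proof (cases k)
    case (Suc n)
    have "Ck_on (Suc n) Re S"
      by (rule Ck_on_SucI[of _ _ "\<lambda>_. 1" "\<lambda>_. 0"])
        (auto intro!: Ck_on_const derivative_eq_intros)
    moreover have "Ck_on (Suc n) Im S"
      by (rule Ck_on_SucI[of _ _ "\<lambda>_. 0" "\<lambda>_. 1"])
        (auto intro!: Ck_on_const derivative_eq_intros)
    ultimately show ?thesis
      using Suc by simp
  qed (auto intro!: continuous_intros)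
  then show "Ck_on k Re S" "Ck_on k Im S" by auto
qed

lemma Ck_on_add: "Ck_on k f S \<Longrightarrow> Ck_on k g S \<Longrightarrow> Ck_on k (\<lambda>z. f z + g z) S"
proof (induction k arbitrary: f g)
  case (Suc k)
  obtain fx fy where f: "\<And>z. z \<in> S \<Longrightarrow> (f has_derivative (\<lambda>v. fx z * Re v + fy z * Im v)) (at z)"
    "Ck_on k fx S" "Ck_on k fy S"
    using Suc.prems unfolding Ck_on.simps by blast
  obtain gx gy where g: "\<And>z. z \<in> S \<Longrightarrow> (g has_derivative (\<lambda>v. gx z * Re v + gy z * Im v)) (at z)"
    "Ck_on k gx S" "Ck_on k gy S"
    using Suc.prems unfolding Ck_on.simps by blast
  show ?case
  proof (rule Ck_on_SucI)
    fix z assume "z \<in> S"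
    show "((\<lambda>z. f z + g z) has_derivative (\<lambda>v. (fx z + gx z) * Re v + (fy z + gy z) * Im v)) (at z)"
      by (rule has_derivative_eq_rhs[OF has_derivative_add[OF f(1) g(1)]]) (use \<open>z \<in> S\<close> in \<open>auto simp: algebra_simps\<close>)
  qed (use f g Suc.IH in auto)
qed (auto intro: continuous_intros)

lemma Ck_on_mult: "Ck_on k f S \<Longrightarrow> Ck_on k g S \<Longrightarrow> Ck_on k (\<lambda>z. f z * g z) S"
proof (induction k arbitrary: f g)
  case (Suc k)
  obtain fx fy where f: "\<And>z. z \<in> S \<Longrightarrow> (f has_derivative (\<lambda>v. fx z * Re v + fy z * Im v)) (at z)"
    "Ck_on k fx S" "Ck_on k fy S"
    using Suc.prems unfolding Ck_on.simps by blast
  obtain gx gy where g: "\<And>z. z \<in> S \<Longrightarrow> (g has_derivative (\<lambda>v. gx z * Re v + gy z * Im v)) (at z)"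
    "Ck_on k gx S" "Ck_on k gy S"
    using Suc.prems unfolding Ck_on.simps by blast
  have fg: "Ck_on k f S" "Ck_on k g S"
    using Suc.prems Ck_on_pred by blast+
  show ?case
  proof (rule Ck_on_SucI)
    fix z assume "z \<in> S"
    show "((\<lambda>z. f z * g z) has_derivative
        (\<lambda>v. (f z * gx z + fx z * g z) * Re v + (f z * gy z + fy z * g z) * Im v)) (at z)"
      by (rule has_derivative_eq_rhs[OF has_derivative_mult[OF f(1) g(1)]]) (use \<open>z \<in> S\<close> in \<open>auto simp: algebra_simps\<close>)
  qed (use f g fg Suc.IH Ck_on_add in auto)
qed (auto intro: continuous_intros)

lemma Ck_on_inverse:
  assumes "\<And>z. z \<in> S \<Longrightarrow> f z \<noteq> 0"
  shows "Ck_on k f S \<Longrightarrow> Ck_on k (\<lambda>z. inverse (f z)) S"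
proof (induction k)
  case 0
  then show ?case
    using assms by (auto intro: continuous_intros)
next
  case (Suc k)
  obtain fx fy where f: "\<And>z. z \<in> S \<Longrightarrow> (f has_derivative (\<lambda>v. fx z * Re v + fy z * Im v)) (at z)"
    "Ck_on k fx S" "Ck_on k fy S"
    using Suc.prems unfolding Ck_on.simps by blast
  have IH: "Ck_on k (\<lambda>z. inverse (f z)) S"
    using Suc Ck_on_pred by blast
  show ?case
  proof (rule Ck_on_SucI)
    fix z assume "z \<in> S"
    show "((\<lambda>z. inverse (f z)) has_derivative (\<lambda>v. (- 1 * fx z * (inverse (f z) * inverse (f z))) * Re v +
        (- 1 * fy z * (inverse (f z) * inverse (f z))) * Im v)) (at z)"
      by (rule has_derivative_eq_rhs[OF Deriv.has_derivative_inverse[OF assms f(1)]]) (use \<open>z \<in> S\<close> in \<open>auto simp: algebra_simps\<close>)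
  qed (intro Ck_on_mult Ck_on_const f IH)+
qed

lemma Ck_on_power: "Ck_on k f S \<Longrightarrow> Ck_on k (\<lambda>z. f z ^ n) S"
  by (induction n) (auto intro: Ck_on_const Ck_on_mult)

lemma Ck_on_prod: "(\<And>i. i \<in> I \<Longrightarrow> Ck_on k (f i) S) \<Longrightarrow> Ck_on k (\<lambda>z. \<Prod>i\<in>I. f i z) S"
  by (induction I rule: infinite_finite_induct) (auto intro: Ck_on_const Ck_on_mult)

lemma Ck_on_cong:
  assumes "open S" "\<And>z. z \<in> S \<Longrightarrow> f z = g z" "Ck_on k f S"
  shows "Ck_on k g S"
proof (cases k)
  case 0
  then show ?thesis
    using assms by (auto intro: continuous_on_eq)
next
  case (Suc n)
  then obtain fx fy where f: "\<And>z. z \<in> S \<Longrightarrow> (f has_derivative (\<lambda>v. fx z * Re v + fy z * Im v)) (at z)"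
    "Ck_on n fx S" "Ck_on n fy S"
    using assms unfolding Suc Ck_on.simps by blast
  show ?thesis
    unfolding Suc
    by (rule Ck_on_SucI[of _ _ fx fy]) (use f assms has_derivative_transform_within_open in \<open>blast+\<close>)
qed

lemma Ck_on_dist_square: "Ck_on k (\<lambda>z. (cmod (z - a))\<^sup>2) S"
proof -
  have "(\<lambda>z. (cmod (z - a))\<^sup>2) = (\<lambda>z. (Re z + - Re a) * (Re z + - Re a) + (Im z + - Im a) * (Im z + - Im a))"
    by (rule ext) (simp only: cmod_power2, simp add: power2_eq_square)
  then show ?thesis
    by (simp only:) (intro Ck_on_add Ck_on_mult Ck_on_Re Ck_on_Im Ck_on_const)
qed

text \<open>In the real coordinates the coefficient of the metric is a rational function.\<close>

lemma Ck_on_weight_square: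
  assumes "U \<subseteq> punctured_plane q \<alpha>" "open U"
  shows "Ck_on k (\<lambda>z. (weight m q \<alpha> z)\<^sup>2) U"
proof (rule Ck_on_cong[OF assms(2)])
  show "Ck_on k (\<lambda>z. (1 + (cmod (z - 0))\<^sup>2) ^ m * inverse (\<Prod>i=1..q-1. (cmod (z - \<alpha> i))\<^sup>2)) U"
    by (intro Ck_on_mult Ck_on_power Ck_on_add Ck_on_const Ck_on_dist_square Ck_on_inverse Ck_on_prod)
      (use assms in \<open>auto simp: punctured_plane_iff subset_iff\<close>)
  fix z
  show "(1 + (cmod (z - 0))\<^sup>2) ^ m * inverse (\<Prod>i=1..q-1. (cmod (z - \<alpha> i))\<^sup>2) = (weight m q \<alpha> z)\<^sup>2"
    by (simp add: weight_def power_divide prod_power_distrib divide_inverse power_mult_distrib power_inverse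
        sqrt_power_squared)
qed

lemma identity_chart:
  assumes "c \<in> pullback_atlas (top_of_set D) (\<lambda>w::complex. w)"
  obtains U where "c = (U, \<lambda>w. w)" "open U" "U \<subseteq> D"
  using assms by (auto simp: pullback_atlas_def dest: openin_imp_subset)

lemma inv_into_identity: "x \<in> U \<Longrightarrow> inv_into U (\<lambda>w. w) x = x"
  using inv_into_f_f[of "\<lambda>w. w" U x] by simp

text \<open>The identity is a global chart, so the charts cover the domain.\<close>

lemma whole_domain_chart:
  assumes "open D"
  shows "(D, \<lambda>w. w) \<in> pullback_atlas (top_of_set D) (\<lambda>w::complex. w)"
proof -
  have "homeomorphic_map (top_of_set D) (top_of_set D) (\<lambda>w. w)"
    using homeomorphic_map_id[of "top_of_set D" "top_of_set D"] by (simp add: id_def)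
  then show ?thesis
    using assms by (simp add: pullback_atlas_def subtopology_subtopology)
qed

lemma deriv_transition_identity:
  assumes "open U" "x \<in> U"
  shows "deriv ((\<lambda>w. w) \<circ> inv_into U (\<lambda>w. w)) x = (1::complex)"
  using differential_pullback_chart[of "\<lambda>w. w" U x] assms by (simp add: differential_def)

lemma second_countable_subset: "second_countable (top_of_set (D :: complex set))"
proof (rule second_countable_subtopology)
  obtain \<B> :: "complex set set" where "countable \<B>" "\<And>C. C \<in> \<B> \<Longrightarrow> open C"
      "\<And>S. open S \<Longrightarrow> \<exists>U. U \<subseteq> \<B> \<and> S = \<Union>U"
    using univ_second_countable by blast
  then show "second_countable (euclidean :: complex topology)"
    unfolding second_countable_def by (intro exI[of _ \<B>]) (simp, metis Union_iff Union_upper subsetD)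
qed

text \<open>All transition maps are restrictions of the identity. A domain that is neither empty nor the whole
  plane is not compact, since it would otherwise be open and closed.\<close>

lemma open_riemann_surface_planar_domain:
  assumes D: "open D" "connected D" "D \<noteq> {}" "D \<noteq> UNIV"
  shows "open_riemann_surface (top_of_set D) (pullback_atlas (top_of_set D) (\<lambda>w::complex. w))"
    (is "open_riemann_surface ?X ?A")
proof -
  have "\<not> compact D"
    using D clopen[of D] compact_imp_closed by blast
  then have noncompact: "\<not> compact_space ?X"
    using compactin_subspace[of euclidean D] by simp
  have charts_cover: "(\<Union>(U, \<phi>)\<in>?A. U) = topspace ?X"
    using whole_domain_chart[OF D(1)] by (auto elim: identity_chart)
  have charts: "\<forall>(U, \<phi>)\<in>?A. openin ?X U \<and> open (\<phi> ` U) \<and>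
      homeomorphic_map (subtopology ?X U) (top_of_set (\<phi> ` U)) \<phi>"
    by (auto simp: pullback_atlas_def)
  have "(\<psi> \<circ> inv_into U \<phi>) holomorphic_on \<phi> ` (U \<inter> V)" if "(U, \<phi>) \<in> ?A" "(V, \<psi>) \<in> ?A" for U \<phi> V \<psi>
  proof -
    have "\<phi> = (\<lambda>w. w)" "\<psi> = (\<lambda>w. w)"
      using that by (auto elim: identity_chart)
    then show ?thesis
      by (auto intro!: holomorphic_transform[OF holomorphic_on_ident] simp: inv_into_identity)
  qed
  then have transitions:
    "\<forall>(U, \<phi>)\<in>?A. \<forall>(V, \<psi>)\<in>?A. (\<psi> \<circ> inv_into U \<phi>) holomorphic_on \<phi> ` (U \<inter> V)"
    by blast
  have connected: "connected_space ?X"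
    using D(2) connectedin_def[of euclidean D] by (simp add: connectedin_iff_connected)
  have hausdorff: "Hausdorff_space ?X"
    by (intro Hausdorff_space_subtopology) simp
  have nonempty: "topspace ?X \<noteq> {}"
    using D by simp
  show ?thesis
    unfolding open_riemann_surface_def riemann_surface_def
    by (intro conjI nonempty connected hausdorff second_countable_subset charts_cover charts transitions noncompact)
qed

lemma omega_form_identity:
  assumes "open U" "x \<in> U"
  shows "omega_form q \<alpha> (\<lambda>w. w) (U, \<lambda>w. w) x = 1 / (\<Prod>i=1..q-1. x - \<alpha> i)"
  using differential_pullback_chart[of "\<lambda>w. w" U x] assms by (simp add: omega_form_def)

lemma holomorphic_1form_omega:
  "holomorphic_1form (pullback_atlas (top_of_set (punctured_plane q \<alpha>)) (\<lambda>w. w)) (omega_form q \<alpha> (\<lambda>w. w))"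
  (is "holomorphic_1form ?A ?\<omega>")
proof -
  have "(?\<omega> (U, \<phi>) \<circ> inv_into U \<phi>) holomorphic_on \<phi> ` U" if U: "(U, \<phi>) \<in> ?A" for U \<phi>
  proof -
    have \<phi>: "\<phi> = (\<lambda>w. w)" "open U" "U \<subseteq> punctured_plane q \<alpha>"
      using U by (auto elim: identity_chart)
    have "(\<lambda>x. 1 / (\<Prod>i=1..q-1. x - \<alpha> i)) holomorphic_on U"
      using \<phi> by (intro holomorphic_intros) (auto simp: punctured_plane_iff subset_iff)
    then show ?thesis
      using \<phi> by (auto elim!: holomorphic_transform simp: inv_into_identity omega_form_identity)
  qed
  moreover have "?\<omega> (U, \<phi>) x = ?\<omega> (V, \<psi>) x * deriv (\<psi> \<circ> inv_into U \<phi>) (\<phi> x)"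
    if "(U, \<phi>) \<in> ?A" "(V, \<psi>) \<in> ?A" "x \<in> U \<inter> V" for U \<phi> V \<psi> x
  proof -
    have "\<phi> = (\<lambda>w. w)" "open U" "\<psi> = (\<lambda>w. w)" "open V"
      using that by (auto elim: identity_chart)
    then show ?thesis
      using that by (simp add: omega_form_identity deriv_transition_identity)
  qed
  ultimately show ?thesis
    unfolding holomorphic_1form_def by blast
qed

lemma conformal_metric_ds2:
  "conformal_metric (pullback_atlas (top_of_set (punctured_plane q \<alpha>)) (\<lambda>w. w))
     (ds2 (top_of_set (punctured_plane q \<alpha>)) m (\<lambda>x. Some x) (omega_form q \<alpha> (\<lambda>w. w)))"
  (is "conformal_metric ?A ?h")
proof -
  have h: "?h (U, \<lambda>w. w) x = (weight m q \<alpha> x)\<^sup>2" if "open U" "x \<in> U" for U x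
    using ds2_eq_weight[of "\<lambda>w. w" U x] that by simp
  have "(\<forall>x\<in>U. ?h (U, \<phi>) x > 0) \<and> (\<forall>k. Ck_on k (?h (U, \<phi>) \<circ> inv_into U \<phi>) (\<phi> ` U))"
    if U: "(U, \<phi>) \<in> ?A" for U \<phi>
  proof -
    have \<phi>: "\<phi> = (\<lambda>w. w)" "open U" "U \<subseteq> punctured_plane q \<alpha>"
      using U by (auto elim: identity_chart)
    have "?h (U, \<phi>) x > 0" if "x \<in> U" for x
      using \<phi> that h weight_pos[of x q \<alpha> m] by auto
    moreover have "Ck_on k (?h (U, \<phi>) \<circ> inv_into U \<phi>) (\<phi> ` U)" for k
      using Ck_on_cong[OF \<phi>(2) _ Ck_on_weight_square[OF \<phi>(3,2)], of m "?h (U, \<phi>) \<circ> inv_into U \<phi>" k] \<phi> h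
      by (simp add: inv_into_identity)
    ultimately show ?thesis by blast
  qed
  moreover have "?h (U, \<phi>) x = ?h (V, \<psi>) x * (cmod (deriv (\<psi> \<circ> inv_into U \<phi>) (\<phi> x)))\<^sup>2"
    if "(U, \<phi>) \<in> ?A" "(V, \<psi>) \<in> ?A" "x \<in> U \<inter> V" for U \<phi> V \<psi> x
  proof -
    have "\<phi> = (\<lambda>w. w)" "open U" "\<psi> = (\<lambda>w. w)" "open V"
      using that by (auto elim: identity_chart)
    then show ?thesis
      using that h by (simp add: deriv_transition_identity)
  qed
  ultimately show ?thesis
    unfolding conformal_metric_def by blast
qed

text \<open>In the chart of the sphere around infinity the coordinate becomes \<open>1 / w\<close>, to be considered only
  where \<open>w \<noteq> 0\<close>.\<close>

lemma meromorphic_function_coordinate: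
  assumes "D \<noteq> {}"
  shows "meromorphic_function (top_of_set D) (pullback_atlas (top_of_set D) (\<lambda>w. w)) (\<lambda>x. Some x)"
    (is "meromorphic_function ?X ?A _")
proof -
  have "continuous_map ?X riemann_sphere (\<lambda>x. Some x)"
  proof -
    have "openin ?X {x \<in> D. Some x \<in> V}" if "openin riemann_sphere V" for V
      using that openin_open_Int[of "Some -` V" D] by (simp add: openin_riemann_sphere Int_def)
    moreover have "topspace riemann_sphere = UNIV"
      using openin_subset[of riemann_sphere UNIV] by (auto simp: openin_riemann_sphere)
    ultimately show ?thesis
      by (simp add: continuous_map_def)
  qed
  moreover have "(\<psi> \<circ> (\<lambda>x. Some x) \<circ> inv_into U \<phi>) holomorphic_on \<phi> ` (U \<inter> (\<lambda>x. Some x) -` V)"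
    if UV: "(U, \<phi>) \<in> ?A" "(V, \<psi>) \<in> riemann_sphere_atlas" for U \<phi> V \<psi>
  proof -
    have \<phi>: "\<phi> = (\<lambda>w. w)"
      using UV by (auto elim: identity_chart)
    consider "V = range Some" "\<psi> = the"
      | "V = - {Some 0}" "\<psi> = (\<lambda>x. case x of None \<Rightarrow> 0 | Some w \<Rightarrow> 1 / w)"
      using UV unfolding riemann_sphere_atlas_def by blast
    then show ?thesis
    proof cases
      case 1
      then show ?thesis
        using \<phi> by (auto intro!: holomorphic_transform[OF holomorphic_on_ident] simp: inv_into_identity)
    next
      case 2
      have "(\<lambda>w. 1 / w) holomorphic_on U - {0}"
        by (intro holomorphic_intros) auto
      then show ?thesis
        using 2 \<phi> by (auto elim!: holomorphic_transform[OF holomorphic_on_subset] simp: inv_into_identity)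
    qed
  qed
  ultimately show ?thesis
    using assms by (auto simp: meromorphic_function_def holomorphic_map_def)
qed

lemma punctured_plane_nonempty: "punctured_plane q \<alpha> \<noteq> {}"
proof -
  have "finite (\<alpha> ` {1..q-1})" by simp
  then show ?thesis
    unfolding punctured_plane_def using infinite_UNIV_char_0[where 'a = complex] by (metis Compl_empty_eq double_complement)
qed

lemma complete_punctured_plane_iff:
  assumes "q \<ge> 2"
  shows "complete_metric (top_of_set (punctured_plane q \<alpha>)) (pullback_atlas (top_of_set (punctured_plane q \<alpha>)) (\<lambda>w. w))
      (ds2 (top_of_set (punctured_plane q \<alpha>)) m (\<lambda>x. Some x) (omega_form q \<alpha> (\<lambda>w. w))) \<longleftrightarrow> q \<le> m + 2"
proof -
  have "covering_space (punctured_plane q \<alpha>) (\<lambda>w. w) (punctured_plane q \<alpha>)"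
    by (rule homeomorphism_imp_covering_space[of _ _ _ "\<lambda>w. w"]) (auto simp: homeomorphism_def)
  then show ?thesis
    using complete_cover_iff[OF assms _ connected_punctured_plane] by blast
qed

text \<open>With \<open>q = m + 2\<close> the punctured plane is still complete; the punctures are placed at
  \<open>1, \<dots>, m + 1\<close>.\<close>

lemma complete_surface_omitting:
  fixes m :: nat
  shows "\<exists>(X :: complex topology) \<A> \<omega> g.
            open_riemann_surface X \<A> \<and> holomorphic_1form \<A> \<omega> \<and>
            meromorphic_function X \<A> g \<and> \<not> g constant_on topspace X \<and>
            conformal_metric \<A> (ds2 X m g \<omega>) \<and> complete_metric X \<A> (ds2 X m g \<omega>) \<and>
            omits_distinct_values X g (m + 2)"
proof -
  define \<alpha> :: "nat \<Rightarrow> complex" where "\<alpha> = of_nat"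
  define D where "D = punctured_plane (m + 2) \<alpha>"
  have "\<alpha> 1 \<notin> D"
    by (simp add: D_def punctured_plane_def)
  then have D: "open D" "connected D" "D \<noteq> {}" "D \<noteq> UNIV"
    unfolding D_def by (auto simp: open_punctured_plane connected_punctured_plane punctured_plane_nonempty)
  have "\<not> (\<lambda>x. Some x) constant_on D"
  proof
    assume "(\<lambda>x. Some x) constant_on D"
    moreover obtain a where "a \<in> D"
      using D(3) by blast
    ultimately have "D = {a}"
      unfolding constant_on_def by (metis is_singletonI' is_singleton_the_elem option.inject singletonD D(3))
    then show False
      using D(1) not_open_singleton by metis
  qed
  moreover have "omits_distinct_values (top_of_set D) (\<lambda>x. Some x) (m + 2)"
    by (rule omits_finite_values[of _ \<alpha> "\<lambda>w. w"]) (auto simp: \<alpha>_def D_def inj_on_def)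
  ultimately show ?thesis
    using open_riemann_surface_planar_domain[OF D] meromorphic_function_coordinate[OF D(3)]
      holomorphic_1form_omega[of "m + 2" \<alpha>] conformal_metric_ds2[of "m + 2" \<alpha> m]
      complete_punctured_plane_iff[of "m + 2" \<alpha> m]
    unfolding D_def by (intro exI conjI) auto
qed

section \<open>Sharpness of the bound on omitted values\<close>

theorem proposition1p4:
  fixes m q :: nat and \<alpha> :: "nat \<Rightarrow> complex"
  assumes "m \<ge> 1" and "q \<ge> 2" and "inj_on \<alpha> {1..q-1}"
  shows
    "(let X = top_of_set (punctured_plane q \<alpha>);
          z = (\<lambda>w::complex. w);
          g = (\<lambda>x. Some (z x))
      in omits_distinct_values X g q \<and>
         (complete_metric X (pullback_atlas X z) (ds2 X m g (omega_form q \<alpha> z)) \<longleftrightarrow> q \<le> m + 2))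
     \<and> (\<forall>(E :: 'a::topological_space set) p. universal_cover E p (punctured_plane q \<alpha>) \<longrightarrow>
         (let X = top_of_set E;
              z = p;
              g = (\<lambda>x. Some (z x))
          in omits_distinct_values X g q \<and>
             (complete_metric X (pullback_atlas X z) (ds2 X m g (omega_form q \<alpha> z)) \<longleftrightarrow> q \<le> m + 2)))
     \<and> (\<forall>m::nat. m \<ge> 1 \<longrightarrow>
         (\<exists>(X :: complex topology) \<A> \<omega> g.
            open_riemann_surface X \<A> \<and> holomorphic_1form \<A> \<omega> \<and>
            meromorphic_function X \<A> g \<and> \<not> g constant_on topspace X \<and>
            conformal_metric \<A> (ds2 X m g \<omega>) \<and> complete_metric X \<A> (ds2 X m g \<omega>) \<and>
            omits_distinct_values X g (m + 2)))"
proof (intro conjI allI impI)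
  show "let X = top_of_set (punctured_plane q \<alpha>); z = (\<lambda>w::complex. w); g = (\<lambda>x. Some (z x))
      in omits_distinct_values X g q \<and>
         (complete_metric X (pullback_atlas X z) (ds2 X m g (omega_form q \<alpha> z)) \<longleftrightarrow> q \<le> m + 2)"
    using omits_finite_values[OF assms(2,3), of "\<lambda>w. w" "top_of_set (punctured_plane q \<alpha>)"]
      complete_punctured_plane_iff[OF assms(2), of \<alpha> m]
    by (simp add: Let_def)
next
  fix E :: "'a set" and p
  assume "universal_cover E p (punctured_plane q \<alpha>)"
  then have E: "covering_space E p (punctured_plane q \<alpha>)" "connected E"
    using simply_connected_imp_connected_space by (auto simp: universal_cover_def)
  then have "p ` E = punctured_plane q \<alpha>"
    by (simp add: covering_space_imp_surjective)
  then show "let X = top_of_set E; z = p; g = (\<lambda>x. Some (z x))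
      in omits_distinct_values X g q \<and>
         (complete_metric X (pullback_atlas X z) (ds2 X m g (omega_form q \<alpha> z)) \<longleftrightarrow> q \<le> m + 2)"
    using omits_finite_values[OF assms(2,3), of p "top_of_set E"] complete_cover_iff[OF assms(2) E, of m]
    by (simp add: Let_def)
qed (rule complete_surface_omitting)

end
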